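(* Assume that $c:\mathcal E\to\mathcal F$ and $f:\mathcal E\to\mathbb R$ are twice continuously differentiable. Let $x^*\in\mathcal M=\{x:c(x)=0\}$, with $\mathrm Dc(x^* )$ of full rank, be a local minimizer of $f$ subject to $c(x)=0$ such that the Riemannian Hessian $\mathrm{Hess}^{\mathcal E}_{\mathcal M_{x^*}}f(x^* )$ is positive definite at $x^*$. If the metric $g$ is set such that the normal space is $$\mathrm N_{x_k}\mathcal M_{x_k}=\big(\nabla^2_{\mathcal E}\mathcal L(x_k,\lambda^*(x_k))\,\mathrm T_{x_k}\mathcal M_{x_k}\big)^{\perp,\mathcal E},$$ then for any $x_0\in\mathcal E$ sufficiently close to $x^*$, the Riemannian--Newton landing iterates $$x_{k+1}=x_k-\mathrm{Hess}^{g,A}_{\mathcal M_{x_k}}f(x_k)^{-1}\mathrm{grad}^g_{\mathcal M_{x_k}}f(x_k)-\mathrm Dc(x_k)^{\dagger,g}c(x_k)$$ are well-defined and converge quadratically to $x^*$: there exists a constant $\gamma>0$ independent of $k\in\mathbb N$ such that $$\|x_{k+1}-x^*\|_{\mathcal E}\le\gamma\|x_k-x^*\|_{\mathcal E}^2\qquad\text{for all }k\in\mathbb N.$$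
   Context: $\mathcal E,\mathcal F$ are finite-dimensional Euclidean spaces, $m=\dim\mathcal F<\dim\mathcal E$; $\mathcal D=\{x:\operatorname{rank}\mathrm Dc(x)=m\}$; for $x\in\mathcal D$, $\mathcal M_x=\{y:c(y)=c(x)\}$ and $\mathrm T_x\mathcal M_x=\ker\mathrm Dc(x)$. $V^{\perp,\mathcal E}$ is the Euclidean orthogonal complement. $\mathcal L(x,\lambda)=f(x)-\langle\lambda,c(x)\rangle_{\mathcal F}$; $\nabla^2_{\mathcal E}\mathcal L$ is its Euclidean Hessian in $x$; $\lambda^*(x)=(\mathrm Dc(x)\mathrm Dc(x)^{*,\mathcal E})^{-1}\mathrm Dc(x)\nabla_{\mathcal E}f(x)$ is the least-squares multiplier, where $\nabla_{\mathcal E}f$ is the Euclidean gradient and $^{*,\mathcal E}$ the Euclidean adjoint. $\mathrm{Proj}_{x,\mathcal E}$ is the Euclidean orthogonal projector onto $\mathrm T_x\mathcal M_x$, and $\mathrm{Hess}^{\mathcal E}_{\mathcal M_x}f(x)=\mathrm{Proj}_{x,\mathcal E}\nabla^2_{\mathcal E}\mathcal L(x,\lambda^*(x))\mathrm{Proj}_{x,\mathcal E}$, viewed as an operator on $\mathrm T_x\mathcal M_x$, is the Riemannian Hessian of $f$ on $\mathcal M_x$ for the Euclidean metric. $g_x(\xi,\zeta)=\langle G(x)\xi,\zeta\rangle_{\mathcal E}$ is a Riemannian metric on $\mathcal E$ ($G(x)$ symmetric positive definite, smooth in $x$). The normal space $\mathrm N_x\mathcal M_x$ associated with $g$ is $\{v\in\mathcal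 E:g_x(v,\xi)=0\ \forall\xi\in\mathrm T_x\mathcal M_x\}$. $\mathrm{grad}^g_{\mathcal M_x}f(x)\in\mathrm T_x\mathcal M_x$ is defined by $g_x(\mathrm{grad}^g_{\mathcal M_x}f(x),\xi)=\mathrm Df(x)[\xi]$ for all $\xi\in\mathrm T_x\mathcal M_x$. $\mathrm Dc(x)^{*,g}=G(x)^{-1}\mathrm Dc(x)^{*,\mathcal E}$, $\mathrm Dc(x)^{\dagger,g}=\mathrm Dc(x)^{*,g}(\mathrm Dc(x)\mathrm Dc(x)^{*,g})^{-1}$. $\nabla^A$ is an affine connection on the manifolds $\mathcal M_x$; any such connection can be written $\nabla^A_\xi\eta=\mathrm{Proj}_{x,\mathcal E}(\mathrm D_\xi\eta)+A(\xi,\eta)$, where $\mathrm D_\xi\eta$ is the directional derivative in $\mathcal E$ and $A:\mathrm T_x\mathcal M_x\times\mathrm T_x\mathcal M_x\to\mathrm T_x\mathcal M_x$ is bilinear. The Riemannian Hessian with respect to $g$ and $\nabla^A$ is the operator on $\mathrm T_x\mathcal M_x$ given by $\mathrm{Hess}^{g,A}_{\mathcal M_x}f(x)[\xi]=\nabla^A_\xi\,\mathrm{grad}^g_{\mathcal M_x}f(x)$.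
   Formalization: The second derivatives of c and f are also assumed Lipschitz near x*, since twice continuous differentiability alone fails (c=t, f=s²/2+|s|^{5/2} gives order 3/2); A is taken continuous in x and the normal-space condition is assumed for all x near x*. *)

theory Defs
  imports "HOL-Analysis.Analysis"
begin

section \<open>Regularity\<close>

definition C1 :: "('a::real_normed_vector \<Rightarrow> 'b::real_normed_vector) \<Rightarrow> bool" where
  "C1 h \<longleftrightarrow> (\<exists>h' :: 'a \<Rightarrow> 'a \<Rightarrow>\<^sub>L 'b.
     (\<forall>x. (h has_derivative blinfun_apply (h' x)) (at x)) \<and> continuous_on UNIV h')"

definition C2 :: "('a::real_normed_vector \<Rightarrow> 'b::real_normed_vector) \<Rightarrow> bool" where
  "C2 h \<longleftrightarrow> (\<exists>h' :: 'a \<Rightarrow> 'a \<Rightarrow>\<^sub>L 'b.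
     (\<forall>x. (h has_derivative blinfun_apply (h' x)) (at x)) \<and> C1 h')"

text \<open>Twice continuous differentiability alone does not give a quadratic rate for a Newton
  iteration: for \<open>f (s, t) = s^2/2 + \<bar>s\<bar> powr (5/2)\<close> and \<open>c (s, t) = t\<close> with the Euclidean metric
  and \<open>A = 0\<close>, the iteration converges to \<open>0\<close> with order exactly \<open>3/2\<close>.  The following
  condition supplies the missing regularity of the second derivative.\<close>

definition second_derivative_lipschitz_near ::
    "('a::real_normed_vector \<Rightarrow> 'b::real_normed_vector) \<Rightarrow> 'a \<Rightarrow> bool" where
  "second_derivative_lipschitz_near h p \<longleftrightarrow>
     (\<exists>\<epsilon> L (h' :: 'a \<Rightarrow> 'a \<Rightarrow>\<^sub>L 'b) (h'' :: 'a \<Rightarrow> 'a \<Rightarrow>\<^sub>L 'a \<Rightarrow>\<^sub>L 'b).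
        \<epsilon> > 0 \<and>
        (\<forall>x \<in> ball p \<epsilon>. (h has_derivative blinfun_apply (h' x)) (at x) \<and>
                       (h' has_derivative blinfun_apply (h'' x)) (at x)) \<and>
        L-lipschitz_on (ball p \<epsilon>) h'')"

section \<open>Euclidean objects\<close>

abbreviation Dv :: "('a::real_normed_vector \<Rightarrow> 'b::real_normed_vector) \<Rightarrow> 'a \<Rightarrow> 'a \<Rightarrow> 'b" where
  "Dv h x \<equiv> frechet_derivative h (at x)"

definition egrad :: "('a::euclidean_space \<Rightarrow> real) \<Rightarrow> 'a \<Rightarrow> 'a" where
  "egrad h x = (THE v. GDERIV h x :> v)"

definition ehess :: "('a::euclidean_space \<Rightarrow> real) \<Rightarrow> 'a \<Rightarrow> 'a \<Rightarrow> 'a" where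
  "ehess h x = Dv (egrad h) x"

definition orth_proj :: "'a::euclidean_space set \<Rightarrow> 'a \<Rightarrow> 'a" where
  "orth_proj S v = (THE p. p \<in> S \<and> v - p \<in> S\<^sup>\<bottom>)"

text \<open>The set \<open>\<D>\<close> of points where the derivative of \<open>c\<close> has full rank.\<close>

definition regular_points :: "('a::euclidean_space \<Rightarrow> 'b::euclidean_space) \<Rightarrow> 'a set" where
  "regular_points c = {x. dim (range (Dv c x)) = DIM('b)}"

text \<open>Tangent space at \<open>x\<close> of the level set \<open>{y. c y = c x}\<close>; meaningful for
  \<open>x \<in> regular_points c\<close>.\<close>

definition tangent :: "('a::euclidean_space \<Rightarrow> 'b::euclidean_space) \<Rightarrow> 'a \<Rightarrow> 'a set" where
  "tangent c x = {\<xi>. Dv c x \<xi> = 0}"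

definition lagrangian ::
    "('a::euclidean_space \<Rightarrow> real) \<Rightarrow> ('a \<Rightarrow> 'b::euclidean_space) \<Rightarrow> 'b \<Rightarrow> 'a \<Rightarrow> real" where
  "lagrangian f c l x = f x - l \<bullet> c x"

definition ls_multiplier ::
    "('a::euclidean_space \<Rightarrow> real) \<Rightarrow> ('a \<Rightarrow> 'b::euclidean_space) \<Rightarrow> 'a \<Rightarrow> 'b" where
  "ls_multiplier f c x = inv (Dv c x \<circ> adjoint (Dv c x)) (Dv c x (egrad f x))"

text \<open>The multiplier is frozen at its value at \<open>x\<close> while the Hessian is taken.\<close>

definition lagrangian_hess ::
    "('a::euclidean_space \<Rightarrow> real) \<Rightarrow> ('a \<Rightarrow> 'b::euclidean_space) \<Rightarrow> 'a \<Rightarrow> 'a \<Rightarrow> 'a" where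
  "lagrangian_hess f c x = ehess (lagrangian f c (ls_multiplier f c x)) x"

definition riem_hess_E ::
    "('a::euclidean_space \<Rightarrow> real) \<Rightarrow> ('a \<Rightarrow> 'b::euclidean_space) \<Rightarrow> 'a \<Rightarrow> 'a \<Rightarrow> 'a" where
  "riem_hess_E f c x =
     orth_proj (tangent c x) \<circ> lagrangian_hess f c x \<circ> orth_proj (tangent c x)"

definition constrained_local_min ::
    "('a::euclidean_space \<Rightarrow> real) \<Rightarrow> ('a \<Rightarrow> 'b::euclidean_space) \<Rightarrow> 'a \<Rightarrow> bool" where
  "constrained_local_min f c p \<longleftrightarrow>
     c p = 0 \<and> (\<exists>\<epsilon>>0. \<forall>y \<in> ball p \<epsilon>. c y = 0 \<longrightarrow> f p \<le> f y)"

section \<open>Metric and connection\<close>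

definition gmetric :: "('a::euclidean_space \<Rightarrow> 'a \<Rightarrow>\<^sub>L 'a) \<Rightarrow> 'a \<Rightarrow> 'a \<Rightarrow> 'a \<Rightarrow> real" where
  "gmetric G x u v = G x u \<bullet> v"

text \<open>Only one continuous derivative of \<open>G\<close> is required; this is what makes the Riemannian
  gradient below differentiable.\<close>

definition riemannian_metric :: "('a::euclidean_space \<Rightarrow> 'a \<Rightarrow>\<^sub>L 'a) \<Rightarrow> bool" where
  "riemannian_metric G \<longleftrightarrow> C1 G \<and>
     (\<forall>x u v. gmetric G x u v = gmetric G x v u) \<and>
     (\<forall>x u. u \<noteq> 0 \<longrightarrow> gmetric G x u u > 0)"

definition g_normal_space ::
    "('a::euclidean_space \<Rightarrow> 'b::euclidean_space) \<Rightarrow> ('a \<Rightarrow> 'a \<Rightarrow>\<^sub>L 'a) \<Rightarrow> 'a \<Rightarrow> 'a set" where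
  "g_normal_space c G x = {v. \<forall>\<xi> \<in> tangent c x. gmetric G x v \<xi> = 0}"

definition riem_grad ::
    "('a::euclidean_space \<Rightarrow> real) \<Rightarrow> ('a \<Rightarrow> 'b::euclidean_space) \<Rightarrow> ('a \<Rightarrow> 'a \<Rightarrow>\<^sub>L 'a) \<Rightarrow> 'a \<Rightarrow> 'a" where
  "riem_grad f c G x =
     (THE v. v \<in> tangent c x \<and> (\<forall>\<xi> \<in> tangent c x. gmetric G x v \<xi> = Dv f x \<xi>))"

definition adjoint_g ::
    "('a::euclidean_space \<Rightarrow> 'b::euclidean_space) \<Rightarrow> ('a \<Rightarrow> 'a \<Rightarrow>\<^sub>L 'a) \<Rightarrow> 'a \<Rightarrow> 'b \<Rightarrow> 'a" where
  "adjoint_g c G x = inv (blinfun_apply (G x)) \<circ> adjoint (Dv c x)"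

definition pinv_g ::
    "('a::euclidean_space \<Rightarrow> 'b::euclidean_space) \<Rightarrow> ('a \<Rightarrow> 'a \<Rightarrow>\<^sub>L 'a) \<Rightarrow> 'a \<Rightarrow> 'b \<Rightarrow> 'a" where
  "pinv_g c G x = adjoint_g c G x \<circ> inv (Dv c x \<circ> adjoint_g c G x)"

text \<open>The affine connections are represented by their bilinear part \<open>A\<close>.  Only the values of
  \<open>A x\<close> on \<open>tangent c x \<times> tangent c x\<close> matter; they are the restriction of a bilinear map on the
  whole space, which is no loss of generality since one may precompose with the orthogonal
  projectors, which vary continuously with \<open>x\<close>.\<close>

definition connection_field ::
    "('a::euclidean_space \<Rightarrow> 'b::euclidean_space) \<Rightarrow> ('a \<Rightarrow> 'a \<Rightarrow>\<^sub>L 'a \<Rightarrow>\<^sub>L 'a) \<Rightarrow> bool" where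
  "connection_field c A \<longleftrightarrow> continuous_on (regular_points c) A \<and>
     (\<forall>x \<in> regular_points c. \<forall>\<xi> \<in> tangent c x. \<forall>\<zeta> \<in> tangent c x. A x \<xi> \<zeta> \<in> tangent c x)"

text \<open>\<open>connection c A x \<xi> \<eta>\<close> is the covariant derivative at \<open>x\<close> of the vector field \<open>\<eta>\<close> in the
  direction \<open>\<xi>\<close>.\<close>

definition connection ::
    "('a::euclidean_space \<Rightarrow> 'b::euclidean_space) \<Rightarrow> ('a \<Rightarrow> 'a \<Rightarrow>\<^sub>L 'a \<Rightarrow>\<^sub>L 'a) \<Rightarrow>
     'a \<Rightarrow> 'a \<Rightarrow> ('a \<Rightarrow> 'a) \<Rightarrow> 'a" where
  "connection c A x \<xi> \<eta> = orth_proj (tangent c x) (Dv \<eta> x \<xi>) + A x \<xi> (\<eta> x)"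

definition riem_hess ::
    "('a::euclidean_space \<Rightarrow> real) \<Rightarrow> ('a \<Rightarrow> 'b::euclidean_space) \<Rightarrow> ('a \<Rightarrow> 'a \<Rightarrow>\<^sub>L 'a) \<Rightarrow>
     ('a \<Rightarrow> 'a \<Rightarrow>\<^sub>L 'a \<Rightarrow>\<^sub>L 'a) \<Rightarrow> 'a \<Rightarrow> 'a \<Rightarrow> 'a" where
  "riem_hess f c G A x \<xi> = connection c A x \<xi> (riem_grad f c G)"

section \<open>The Riemannian-Newton landing iteration\<close>

definition landing_step ::
    "('a::euclidean_space \<Rightarrow> real) \<Rightarrow> ('a \<Rightarrow> 'b::euclidean_space) \<Rightarrow> ('a \<Rightarrow> 'a \<Rightarrow>\<^sub>L 'a) \<Rightarrow>
     ('a \<Rightarrow> 'a \<Rightarrow>\<^sub>L 'a \<Rightarrow>\<^sub>L 'a) \<Rightarrow> 'a \<Rightarrow> 'a" where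
  "landing_step f c G A x =
     x - inv_into (tangent c x) (riem_hess f c G A x) (riem_grad f c G x) - pinv_g c G x (c x)"

text \<open>All derivatives and inverses in \<open>landing_step\<close> exist at \<open>x\<close>, rather than being the
  arbitrary values that \<open>frechet_derivative\<close>, \<open>inv\<close>, \<open>inv_into\<close> and \<open>THE\<close> otherwise return.\<close>

definition landing_step_defined ::
    "('a::euclidean_space \<Rightarrow> real) \<Rightarrow> ('a \<Rightarrow> 'b::euclidean_space) \<Rightarrow> ('a \<Rightarrow> 'a \<Rightarrow>\<^sub>L 'a) \<Rightarrow>
     ('a \<Rightarrow> 'a \<Rightarrow>\<^sub>L 'a \<Rightarrow>\<^sub>L 'a) \<Rightarrow> 'a \<Rightarrow> bool" where
  "landing_step_defined f c G A x \<longleftrightarrow>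
     x \<in> regular_points c \<and>
     (\<exists>!v. v \<in> tangent c x \<and> (\<forall>\<xi> \<in> tangent c x. gmetric G x v \<xi> = Dv f x \<xi>)) \<and>
     riem_grad f c G differentiable (at x) \<and>
     bij_betw (riem_hess f c G A x) (tangent c x) (tangent c x) \<and>
     bij (blinfun_apply (G x)) \<and>
     bij (Dv c x \<circ> adjoint_g c G x)"

primrec landing_iter ::
    "('a::euclidean_space \<Rightarrow> real) \<Rightarrow> ('a \<Rightarrow> 'b::euclidean_space) \<Rightarrow> ('a \<Rightarrow> 'a \<Rightarrow>\<^sub>L 'a) \<Rightarrow>
     ('a \<Rightarrow> 'a \<Rightarrow>\<^sub>L 'a \<Rightarrow>\<^sub>L 'a) \<Rightarrow> 'a \<Rightarrow> nat \<Rightarrow> 'a" where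
  "landing_iter f c G A x0 0 = x0"
| "landing_iter f c G A x0 (Suc k) = landing_step f c G A (landing_iter f c G A x0 k)"

end

theory Submission
  imports Defs
begin

text \<open>Let \<open>p\<close> be the minimizer, \<open>e = x - p\<close>, \<open>T = tangent c x\<close>, and let \<open>H\<close> be the Lagrangian Hessian
  at \<open>x\<close> with the least-squares multiplier.  The Riemannian gradient vanishes to first order at \<open>p\<close>, so
  up to terms of order \<open>norm e\<close> the Riemannian Hessian represents the form of \<open>H\<close> on \<open>T\<close> in the metric
  \<open>g\<close>: the derivative of \<open>G\<close> and the connection only enter through these terms.  Hence the tangential
  step \<open>s\<close> satisfies \<open>H s \<bullet> \<zeta> = Dv f x \<zeta> + O((norm e)\<^sup>2) * norm \<zeta>\<close> for \<open>\<zeta>\<close> in \<open>T\<close>.  The normal step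
  \<open>n\<close> satisfies \<open>Dv c x n = c x\<close>, and the assumption on the normal space together with the symmetry of
  \<open>H\<close> gives \<open>H n \<bullet> \<zeta> = 0\<close>.  So \<open>s + n\<close> solves the Newton system of the Lagrange conditions up to second
  order, and so does \<open>e\<close> by Taylor expansion at \<open>x\<close>.  The difference \<open>d = e - s - n\<close> is therefore
  \<open>O((norm e)\<^sup>2)\<close>, because \<open>H\<close> is uniformly coercive on \<open>T\<close> and \<open>Dv c x\<close> has a bounded right inverse.\<close>

section \<open>Second derivatives and differentiable linear systems\<close>

text \<open>The Riemannian gradient is a \<open>THE\<close> over a tangent space that moves with x,
  so its definition gives no derivative. It is therefore obtained, together with a multiplier, from
  a square linear system on the fixed space \<open>'a \<times> 'b\<close> with differentiable
  coefficients; the derivative of the gradient, and with it the Hessian, comes from that system. The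
  multiplier \<mu> of this system belongs to the metric g and is in general not the least-squares
  multiplier of the Lagrangian Hessian. The two agree at p and differ by \<open>O(norm e)\<close>
  nearby, which is the accuracy at which the two Hessians are compared. Second order mostly arises
  as a product of two first-order factors. The exception is the linearization of the derivatives of
  f and c, where the Lipschitz bounds on the second derivatives supply it; continuity alone would
  leave a remainder \<open>o(norm e)\<close>.\<close>

lemma second_difference_bound:
  fixes h :: "'a::real_normed_vector \<Rightarrow> 'b::real_normed_vector"
  assumes h: "\<And>y. y \<in> ball x r \<Longrightarrow> (h has_derivative blinfun_apply (h' y)) (at y)"
    and h': "\<And>z. norm z < r \<Longrightarrow> norm (h' (x + z) - h' x - H z) \<le> \<eta> * norm z"
    and H: "bounded_linear H" and \<eta>: "0 \<le> \<eta>"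
    and t: "0 < t" "t * (norm u + norm v) < r"
  shows "norm (h (x + t *\<^sub>R u + t *\<^sub>R v) - h (x + t *\<^sub>R u) - h (x + t *\<^sub>R v) + h x
           - t\<^sup>2 *\<^sub>R blinfun_apply (H u) v) \<le> t\<^sup>2 * (2 * \<eta> * (norm u + norm v)\<^sup>2)"
proof -
  interpret H: bounded_linear H by fact
  let ?N = "norm u + norm v"
  \<comment> \<open>The increment of \<phi> from 0 to t is the mixed second difference minus
    \<open>t\<^sup>2 *\<^sub>R H u v\<close>, so the mean value inequality for one real variable
    applies.\<close>
  define \<phi> where "\<phi> s = h (x + t *\<^sub>R u + s *\<^sub>R v) - h (x + s *\<^sub>R v) - s *\<^sub>R (t *\<^sub>R blinfun_apply (H u) v)" for s
  define \<psi> where "\<psi> s d = h' (x + t *\<^sub>R u + s *\<^sub>R v) (d *\<^sub>R v) - h' (x + s *\<^sub>R v) (d *\<^sub>R v)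
      - d *\<^sub>R (t *\<^sub>R blinfun_apply (H u) v)" for s d
  have dist_add: "dist x (x + z) = norm z" for z by (simp add: dist_norm)
  have small: "norm (t *\<^sub>R u + s *\<^sub>R v) \<le> t * ?N" "norm (s *\<^sub>R v) \<le> t * ?N" if "s \<in> {0..t}" for s
  proof -
    have "s * norm v \<le> t * norm v" using that by (simp add: mult_right_mono)
    moreover have "norm (t *\<^sub>R u + s *\<^sub>R v) \<le> t * norm u + s * norm v"
      using that t norm_triangle_ineq[of "t *\<^sub>R u" "s *\<^sub>R v"] by simp
    moreover have "0 \<le> t * norm u" "norm (s *\<^sub>R v) = s * norm v" using t that by simp_all
    ultimately show "norm (t *\<^sub>R u + s *\<^sub>R v) \<le> t * ?N" "norm (s *\<^sub>R v) \<le> t * ?N"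
      unfolding distrib_left by linarith+
  qed
  have der: "(\<phi> has_derivative \<psi> s) (at s within {0..t})" if s: "s \<in> {0..t}" for s
  proof -
    have "(h has_derivative h' (x + t *\<^sub>R u + s *\<^sub>R v)) (at (x + t *\<^sub>R u + s *\<^sub>R v))"
      using small(1)[OF s] t(2) by (intro h) (simp only: mem_ball dist_add add.assoc)
    moreover have "(h has_derivative h' (x + s *\<^sub>R v)) (at (x + s *\<^sub>R v))"
      using small(2)[OF s] t(2) by (intro h) (simp only: mem_ball dist_add)
    ultimately show ?thesis unfolding \<phi>_def \<psi>_def
      by (auto intro!: derivative_eq_intros
          has_derivative_compose[where f="\<lambda>s. x + t *\<^sub>R u + s *\<^sub>R v" and g=h]
          has_derivative_compose[where f="\<lambda>s. x + s *\<^sub>R v" and g=h])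
  qed
  have bnd: "onorm (\<psi> s) \<le> t * (2 * \<eta> * ?N * norm v)" if s: "s \<in> {0..t}" for s
  proof (rule onorm_bound)
    show "0 \<le> t * (2 * \<eta> * ?N * norm v)" using t \<eta> by simp
    fix d :: real
    let ?z1 = "t *\<^sub>R u + s *\<^sub>R v" and ?z2 = "s *\<^sub>R v"
    \<comment> \<open>The expansions of \<open>h'\<close> at the two points share
      \<open>h' x\<close> and \<open>H (s *\<^sub>R v)\<close>. What survives,
      \<open>H (t *\<^sub>R u)\<close>, is the term subtracted in \<phi>, so only the two remainders
      are left.\<close>
    let ?R = "(h' (x + ?z1) - h' x - H ?z1) - (h' (x + ?z2) - h' x - H ?z2)"
    have "\<psi> s d = d *\<^sub>R (?R v)"
      unfolding \<psi>_def
      by (simp add: blinfun.diff_left blinfun.scaleR_right blinfun.scaleR_left H.add H.scaleR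
          blinfun.add_left algebra_simps)
    moreover have "norm ?R \<le> \<eta> * (t * ?N) + \<eta> * (t * ?N)"
    proof -
      have *: "norm (h' (x + z) - h' x - H z) \<le> \<eta> * (t * ?N)" if "norm z \<le> t * ?N" for z
        using h'[of z] that t(2) mult_left_mono[OF that \<eta>] by linarith
      show ?thesis
        by (rule order_trans[OF norm_triangle_ineq4]) (intro add_mono * small[OF s])
    qed
    moreover have "norm (?R v) \<le> norm ?R * norm v" by (rule norm_blinfun)
    ultimately have "norm (\<psi> s d) \<le> \<bar>d\<bar> * ((\<eta> * (t * ?N) + \<eta> * (t * ?N)) * norm v)"
      by (auto intro!: mult_left_mono intro: order_trans[OF _ mult_right_mono])
    then show "norm (\<psi> s d) \<le> t * (2 * \<eta> * ?N * norm v) * norm d" by (simp add: algebra_simps)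
  qed
  have "norm (\<phi> t - \<phi> 0) \<le> t * (2 * \<eta> * ?N * norm v) * norm (t - 0)"
    by (rule differentiable_bound[OF _ der bnd]) (use t in auto)
  also have "\<dots> = t\<^sup>2 * (2 * \<eta> * ?N) * norm v"
    using t by (simp add: power2_eq_square)
  also have "\<dots> \<le> t\<^sup>2 * (2 * \<eta> * ?N) * ?N" using \<eta> by (intro mult_left_mono) auto
  also have "\<phi> t - \<phi> 0 = h (x + t *\<^sub>R u + t *\<^sub>R v) - h (x + t *\<^sub>R u) - h (x + t *\<^sub>R v) + h x
           - t\<^sup>2 *\<^sub>R blinfun_apply (H u) v"
    unfolding \<phi>_def by (simp add: power2_eq_square algebra_simps)
  finally show ?thesis by (simp add: power2_eq_square mult.assoc)
qed

text \<open>The second difference is unchanged when u and v are swapped, yet it approximates both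
  \<open>t\<^sup>2 *\<^sub>R H u v\<close> and \<open>t\<^sup>2 *\<^sub>R H v u\<close> up to
  \<open>o(t\<^sup>2)\<close>. This is the source of the symmetry of the Lagrangian Hessian.\<close>

lemma symmetric_second_derivative:
  fixes h :: "'a::real_normed_vector \<Rightarrow> 'b::real_normed_vector"
  assumes h: "\<And>y. y \<in> ball x r \<Longrightarrow> (h has_derivative blinfun_apply (h' y)) (at y)"
    and h': "(h' has_derivative H) (at x)" and r: "0 < r"
  shows "blinfun_apply (H u) v = blinfun_apply (H v) u"
proof -
  let ?K = "4 * (norm u + norm v)\<^sup>2"
  have "norm (H u v - H v u) \<le> e" if "0 < e" for e
  proof -
    \<comment> \<open>The two errors add up to \<open>t\<^sup>2 * (\<eta> * ?K)\<close>; the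
      \<open>+ 1\<close> covers the case u = v = 0.\<close>
    define \<eta> where "\<eta> = e / (?K + 1)"
    have \<eta>: "0 < \<eta>" "\<eta> * ?K \<le> e" using that by (auto simp: \<eta>_def divide_simps add_nonneg_pos)
    obtain d where d: "0 < d" "\<And>y. norm (y - x) < d \<Longrightarrow> norm (h' y - h' x - H (y - x)) \<le> \<eta> * norm (y - x)"
      using h' \<eta>(1) unfolding has_derivative_at_alt by blast
    define \<rho> where "\<rho> = min d r"
    define t where "t = \<rho> / (2 * (norm u + norm v + 1))"
    have pos: "0 < norm u + norm v + 1" by (simp add: add_nonneg_pos)
    have "0 < \<rho>" using d r by (simp add: \<rho>_def)
    then have t: "0 < t" using pos by (simp add: t_def)
    have "t * (norm u + norm v) \<le> t * (norm u + norm v + 1)" using t by simp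
    also have "\<dots> = \<rho> / 2" using pos unfolding t_def by (simp add: field_simps)
    finally have t2: "t * (norm u + norm v) < \<rho>" using \<open>0 < \<rho>\<close> by simp
    have H: "bounded_linear H" using h' by (rule has_derivative_bounded_linear)
    have A: "\<And>y. y \<in> ball x \<rho> \<Longrightarrow> (h has_derivative blinfun_apply (h' y)) (at y)"
      using h by (simp add: \<rho>_def)
    have B: "norm (h' (x + z) - h' x - H z) \<le> \<eta> * norm z" if "norm z < \<rho>" for z
      using d(2)[of "x + z"] that by (simp add: \<rho>_def)
    let ?D = "h (x + t *\<^sub>R u + t *\<^sub>R v) - h (x + t *\<^sub>R u) - h (x + t *\<^sub>R v) + h x"
    have 1: "norm (?D - t\<^sup>2 *\<^sub>R H u v) \<le> t\<^sup>2 * (2 * \<eta> * (norm u + norm v)\<^sup>2)"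
      by (rule second_difference_bound[OF A B H]) (use \<eta> t t2 in auto)
    have "norm (h (x + t *\<^sub>R v + t *\<^sub>R u) - h (x + t *\<^sub>R v) - h (x + t *\<^sub>R u) + h x - t\<^sup>2 *\<^sub>R H v u)
        \<le> t\<^sup>2 * (2 * \<eta> * (norm v + norm u)\<^sup>2)"
      by (rule second_difference_bound[OF A B H]) (use \<eta> t t2 in \<open>auto simp: add.commute\<close>)
    then have 2: "norm (?D - t\<^sup>2 *\<^sub>R H v u) \<le> t\<^sup>2 * (2 * \<eta> * (norm u + norm v)\<^sup>2)"
      by (simp add: algebra_simps)
    have "t\<^sup>2 *\<^sub>R (H u v - H v u) = (?D - t\<^sup>2 *\<^sub>R H v u) - (?D - t\<^sup>2 *\<^sub>R H u v)"
      by (simp add: algebra_simps)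
    then have "t\<^sup>2 * norm (H u v - H v u) = norm ((?D - t\<^sup>2 *\<^sub>R H v u) - (?D - t\<^sup>2 *\<^sub>R H u v))"
      by (metis abs_power2 norm_scaleR)
    also have "\<dots> \<le> t\<^sup>2 * (\<eta> * ?K)"
      using norm_triangle_ineq4[of "?D - t\<^sup>2 *\<^sub>R H v u" "?D - t\<^sup>2 *\<^sub>R H u v"] 1 2
      by (simp add: algebra_simps)
    finally have "norm (H u v - H v u) \<le> \<eta> * ?K" using t by simp
    then show ?thesis using \<eta>(2) by linarith
  qed
  then have "norm (H u v - H v u) \<le> 0" by (rule field_le_epsilon[of _ 0, simplified])
  then show ?thesis by simp
qed


text \<open>Increments are compared with the base point only, so a derivative at that one point
  suffices. The increments of \<open>f'\<close> and \<open>c'\<close> from p are estimated this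
  way.\<close>

lemma has_derivative_local_lipschitz:
  fixes h :: "'a::real_normed_vector \<Rightarrow> 'b::real_normed_vector"
  assumes "(h has_derivative h') (at x)"
  shows "\<exists>C>0. \<forall>\<^sub>F y in nhds x. norm (h y - h x) \<le> C * norm (y - x)"
proof -
  interpret h': bounded_linear h' using assms by (rule has_derivative_bounded_linear)
  obtain d where d: "0 < d" "\<And>y. norm (y - x) < d \<Longrightarrow> norm (h y - h x - h' (y - x)) \<le> 1 * norm (y - x)"
    using assms zero_less_one unfolding has_derivative_at_alt by blast
  obtain K where K: "0 < K" "\<And>z. norm (h' z) \<le> norm z * K" using h'.pos_bounded by blast
  have "norm (h y - h x) \<le> (1 + K) * norm (y - x)" if "dist y x < d" for y
  proof -
    have "norm (h y - h x) \<le> norm (h y - h x - h' (y - x)) + norm (h' (y - x))"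
      by (metis diff_add_cancel norm_triangle_ineq)
    also have "\<dots> \<le> 1 * norm (y - x) + norm (y - x) * K"
      using that by (intro add_mono d(2) K(2)) (simp add: dist_norm)
    finally show ?thesis by (simp add: algebra_simps)
  qed
  then show ?thesis using d(1) K(1) by (intro exI[of _ "1 + K"]) (auto simp: eventually_nhds_metric)
qed

text \<open>The factor that multiplies a vanishing one has only to be continuous, because
  \<open>P (f y) (g y - g x)\<close> is \<open>O(norm (y - x))\<close> times \<open>o(1)\<close>.
  This breaks a circle in the next lemma, where g is the function whose differentiability is being
  proved.\<close>

lemma has_derivative_bilinear_vanishing:
  fixes g :: "'x::real_normed_vector \<Rightarrow> 'b::real_normed_vector"
  assumes bil: "bounded_bilinear P"
    and f: "(f has_derivative f') (at x)" and f0: "f x = 0" and g: "isCont g x"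
  shows "((\<lambda>y. P (f y) (g y)) has_derivative (\<lambda>h. P (f' h) (g x))) (at x)"
proof -
  interpret P: bounded_bilinear P by fact
  obtain K where K: "0 < K" "\<And>a b. norm (P a b) \<le> norm a * norm b * K" using P.pos_bounded by blast
  obtain C where C: "0 < C" "\<forall>\<^sub>F y in nhds x. norm (f y) \<le> C * norm (y - x)"
    using has_derivative_local_lipschitz[OF f] f0 by auto
  have "((\<lambda>y. P (f y) (g y - g x)) has_derivative (\<lambda>_. 0)) (at x)"
    unfolding has_derivative_at_alt
  proof (intro conjI allI impI bounded_linear_zero)
    fix e :: real assume e: "0 < e"
    have "\<forall>\<^sub>F y in nhds x. dist (g y) (g x) < e / (C * K)"
      using g e C(1) K(1) by (auto simp: isCont_def tendsto_at_iff_tendsto_nhds intro!: tendstoD)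
    with C(2) have "\<forall>\<^sub>F y in nhds x. norm (P (f y) (g y - g x)) \<le> e * norm (y - x)"
    proof eventually_elim
      case (elim y)
      have "norm (P (f y) (g y - g x)) \<le> norm (f y) * norm (g y - g x) * K" by (rule K)
      also have "\<dots> \<le> (C * norm (y - x)) * (e / (C * K)) * K"
        using elim C(1) K(1) by (intro mult_right_mono mult_mono) (auto simp: dist_norm)
      finally show ?case using C(1) K(1) by (simp add: field_simps)
    qed
    then show "\<exists>d>0. \<forall>y. norm (y - x) < d \<longrightarrow>
        norm (P (f y) (g y - g x) - P (f x) (g x - g x) - 0) \<le> e * norm (y - x)"
      by (simp add: eventually_nhds_metric dist_norm P.zero_right)
  qed
  from has_derivative_add[OF this bounded_linear.has_derivative[OF P.bounded_linear_left f, of "g x"]]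
  show ?thesis by (simp add: P.diff_right)
qed

text \<open>A left inverse Q of \<open>M x\<close> turns the equation into
  \<open>s y - s x = Q (r y - r x - \<Delta> y (s y))\<close>. Since \<Delta> tends to 0, absorption
  gives continuity of s, and continuity is all that the product with \<Delta> asks of s for the
  right side to be differentiable.\<close>

lemma differentiable_linear_solution:
  fixes M :: "'x::real_normed_vector \<Rightarrow> 'u::euclidean_space \<Rightarrow>\<^sub>L 'u"
  assumes M: "(M has_derivative M') (at x)" and r: "(r has_derivative r') (at x)"
    and inj: "inj (blinfun_apply (M x))"
    and eq: "\<forall>\<^sub>F y in nhds x. M y (s y) = r y"
  shows "s differentiable (at x)"
proof -
  have lin: "linear (blinfun_apply (M x))" by (rule bounded_linear.linear[OF blinfun.bounded_linear_right])
  obtain Q where Q: "linear Q" "\<And>u. Q (M x u) = u"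
    using linear_injective_left_inverse[OF lin inj] by (metis comp_apply id_apply)
  have bQ: "bounded_linear Q" using Q(1) by (simp add: linear_conv_bounded_linear)
  interpret Q: bounded_linear Q by fact
  obtain N where N: "0 < N" "\<And>z. norm (Q z) \<le> norm z * N" using Q.pos_bounded by blast
  define \<Delta> where "\<Delta> y = M y - M x" for y
  have eqx: "M x (s x) = r x" using eventually_nhds_x_imp_x[OF eq] .
  have sol: "\<forall>\<^sub>F y in nhds x. s y - s x = Q (r y - r x - \<Delta> y (s y))"
    using eq
  proof eventually_elim
    case (elim y)
    have "r y - r x - \<Delta> y (s y) = M x (s y - s x)"
      by (simp add: \<Delta>_def blinfun.diff_left blinfun.diff_right elim eqx)
    then show ?case by (simp add: Q)
  qed
  have D: "(\<Delta> has_derivative M') (at x)" unfolding \<Delta>_def by (auto intro!: derivative_eq_intros M)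
  have Dx: "\<Delta> x = 0" by (simp add: \<Delta>_def)
  have D0: "(\<Delta> \<longlongrightarrow> 0) (nhds x)"
    using has_derivative_continuous[OF D] Dx tendsto_at_iff_tendsto_nhds[of \<Delta> x] by (simp add: isCont_def)
  have r0: "((\<lambda>y. r y - r x) \<longlongrightarrow> 0) (nhds x)"
    using has_derivative_continuous[OF r] tendsto_at_iff_tendsto_nhds[of "\<lambda>y. r y - r x" x]
    by (simp add: isCont_def LIM_zero_iff)
  \<comment> \<open>With this radius the term in \<open>s y - s x\<close> on the right is at most
    half of the left side and can be absorbed.\<close>
  have "\<forall>\<^sub>F y in nhds x. dist (\<Delta> y) 0 < 1 / (2 * N)"
    using tendstoD[OF D0] N(1) by simp
  with sol have bound: "\<forall>\<^sub>F y in nhds x. norm (s y - s x) \<le> 2 * N * (norm (r y - r x) + norm (\<Delta> y) * norm (s x))"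
  proof eventually_elim
    case (elim y)
    have "norm (s y - s x) \<le> norm (r y - r x - \<Delta> y (s y)) * N" using elim(1) N(2) by metis
    also have "r y - r x - \<Delta> y (s y) = (r y - r x - \<Delta> y (s x)) - \<Delta> y (s y - s x)"
      by (simp add: blinfun.diff_right)
    also have "norm \<dots> \<le> (norm (r y - r x) + norm (\<Delta> y) * norm (s x)) + norm (\<Delta> y) * norm (s y - s x)"
      by (meson add_mono norm_blinfun norm_triangle_ineq4 order_refl order_trans)
    also have "norm (\<Delta> y) * norm (s y - s x) \<le> 1 / (2 * N) * norm (s y - s x)"
      using elim(2) by (intro mult_right_mono) auto
    finally have "norm (s y - s x) \<le> (norm (r y - r x) + norm (\<Delta> y) * norm (s x)) * N + 1 / (2 * N) * norm (s y - s x) * N"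
      using N(1) by (simp add: distrib_right)
    also have "1 / (2 * N) * norm (s y - s x) * N = norm (s y - s x) / 2" using N(1) by simp
    finally show ?case by (simp add: mult.commute)
  qed
  have "((\<lambda>y. 2 * N * (norm (r y - r x) + norm (\<Delta> y) * norm (s x))) \<longlongrightarrow> 2 * N * (norm (0::'u) + norm (0::'u \<Rightarrow>\<^sub>L 'u) * norm (s x))) (nhds x)"
    by (intro tendsto_intros D0 r0)
  then have "((\<lambda>y. s y - s x) \<longlongrightarrow> 0) (nhds x)"
    by (intro Lim_null_comparison[OF bound]) simp
  then have cont: "isCont s x"
    using tendsto_at_iff_tendsto_nhds[of "\<lambda>y. s y - s x" x] by (simp add: isCont_def LIM_zero_iff)
  have "((\<lambda>y. \<Delta> y (s y)) has_derivative (\<lambda>h. M' h (s x))) (at x)"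
    by (rule has_derivative_bilinear_vanishing[OF bounded_bilinear_blinfun_apply D Dx cont])
  from has_derivative_diff[OF has_derivative_diff[OF r has_derivative_const[of "r x"]] this]
  have "((\<lambda>y. s x + Q (r y - r x - \<Delta> y (s y))) has_derivative (\<lambda>h. 0 + Q (r' h - 0 - M' h (s x)))) (at x)"
    by (intro has_derivative_add has_derivative_const Q.has_derivative)
  then have "((\<lambda>y. s x + Q (r y - r x - \<Delta> y (s y))) has_derivative (\<lambda>h. Q (r' h - M' h (s x)))) (at x)"
    by simp
  then have "(s has_derivative (\<lambda>h. Q (r' h - M' h (s x)))) (at x)"
    by (rule has_derivative_transform_eventually)
      (use sol eventually_nhds_x_imp_x[OF sol] in \<open>auto simp: eventually_at_filter algebra_simps elim: eventually_mono\<close>)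
  then show ?thesis by (rule differentiableI)
qed

text \<open>For \<open>kkt\<close>, a plain linear function, differentiability is easy to check at
  each fixed argument. In finite dimension this is enough: M is assembled from the columns
  \<open>K y i\<close> by fixed bounded linear maps.\<close>

lemma differentiable_componentwise_linear_solution:
  fixes K :: "'x::real_normed_vector \<Rightarrow> 'u::euclidean_space \<Rightarrow> 'u"
  assumes lin: "\<And>y. linear (K y)"
    and K: "\<And>u. (\<lambda>y. K y u) differentiable (at x)"
    and r: "r differentiable (at x)"
    and inj: "inj (K x)"
    and eq: "\<forall>\<^sub>F y in nhds x. K y (s y) = r y"
  shows "s differentiable (at x)"
proof -
  define M :: "'x \<Rightarrow> 'u \<Rightarrow>\<^sub>L 'u" where
    "M y = (\<Sum>i\<in>Basis. blinfun_scaleR_left (K y i) o\<^sub>L blinfun_inner_left i)" for y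
  have M: "blinfun_apply (M y) u = K y u" for y u
  proof -
    have "K y u = K y (\<Sum>i\<in>Basis. (u \<bullet> i) *\<^sub>R i)" by (simp add: euclidean_representation)
    also have "\<dots> = blinfun_apply (M y) u"
      by (simp add: M_def linear_sum[OF lin] linear_cmul[OF lin] blinfun.sum_left inner_commute)
    finally show ?thesis by simp
  qed
  have bl: "bounded_linear (\<lambda>v::'u. blinfun_scaleR_left v o\<^sub>L blinfun_inner_left i)" for i :: 'u
    by (intro bounded_linear_compose[OF
          bounded_bilinear.bounded_linear_left[OF bounded_bilinear_blinfun_compose] bounded_linear_blinfun_scaleR_left])
  have "M differentiable (at x)"
    unfolding M_def
    by (intro differentiable_sum ballI finite_Basis differentiable_compose[OF _ K, unfolded o_def]
        bounded_linear_imp_differentiable[OF bl])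
  then obtain M' where M': "(M has_derivative M') (at x)" by (auto simp: differentiable_def)
  obtain r' where r': "(r has_derivative r') (at x)" using r by (auto simp: differentiable_def)
  have "inj (blinfun_apply (M x))" using inj by (simp add: M inj_def)
  moreover have "\<forall>\<^sub>F y in nhds x. M y (s y) = r y" using eq by (simp add: M)
  ultimately show ?thesis by (rule differentiable_linear_solution[OF M' r'])
qed

section \<open>Linear algebra of the constraint and the metric\<close>

text \<open>Dropping the kernel component of r0 keeps the image and cannot increase the norm. The
  orthogonality is recorded because such an r is annihilated by tangent residuals and is exactly
  what an orthogonal projection onto the kernel removes.\<close>

lemma ex_minimal_norm_preimage:
  fixes J :: "'a::euclidean_space \<Rightarrow> 'b::real_vector"
  assumes "linear J" "J r0 = y"
  shows "\<exists>r. J r = y \<and> norm r \<le> norm r0 \<and> (\<forall>\<zeta>. J \<zeta> = 0 \<longrightarrow> r \<bullet> \<zeta> = 0)"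
proof -
  let ?T = "{\<zeta>. J \<zeta> = 0}"
  have sp: "span ?T = ?T" using linear_subspace_kernel[OF assms(1)] by (simp add: span_eq_iff)
  obtain k r where *: "k \<in> span ?T" "\<And>w. w \<in> span ?T \<Longrightarrow> orthogonal r w" "r0 = k + r"
    using orthogonal_subspace_decomp_exists[of ?T r0] by blast
  have "J k = 0" using *(1) unfolding sp by simp
  then have "J r = y" using assms *(3) by (simp add: linear_add)
  moreover have "norm r \<le> norm r0"
    using *(2)[OF *(1)] norm_add_Pythagorean[of k r] *(3) power2_le_imp_le[of "norm r" "norm r0"]
    by (simp add: orthogonal_commute)
  ultimately show ?thesis using *(2) unfolding sp by (auto simp: orthogonal_def)
qed

text \<open>Composed with a fixed right inverse S of \<open>J p\<close>, the map \<open>J x\<close>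
  is within 1/2 of the identity, hence invertible with inverse bounded by 2. The constant
  \<open>2 * N\<close> is this factor times the bound of S.\<close>

lemma eventually_bounded_right_inverse:
  fixes J :: "'x::topological_space \<Rightarrow> 'a::euclidean_space \<Rightarrow>\<^sub>L 'b::euclidean_space"
  assumes J: "(J \<longlongrightarrow> J p) (nhds p)" and surj: "surj (blinfun_apply (J p))"
  shows "\<exists>C>0. \<forall>\<^sub>F x in nhds p. \<forall>y. \<exists>r. J x r = y \<and> norm r \<le> C * norm y \<and> (\<forall>\<zeta>. J x \<zeta> = 0 \<longrightarrow> r \<bullet> \<zeta> = 0)"
proof -
  obtain S where S: "linear S" "\<And>y. J p (S y) = y"
    using linear_surjective_right_inverse[OF bounded_linear.linear[OF blinfun.bounded_linear_right] surj]
    by (metis comp_apply id_apply)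
  then obtain N where N: "0 < N" "\<And>y. norm (S y) \<le> N * norm y"
    using linear_bounded_pos by blast
  have "\<forall>\<^sub>F x in nhds p. dist (J x) (J p) < 1 / (2 * N)" using tendstoD[OF J] N(1) by simp
  then have "\<forall>\<^sub>F x in nhds p. \<forall>y. \<exists>r. J x r = y \<and> norm r \<le> 2 * N * norm y \<and> (\<forall>\<zeta>. J x \<zeta> = 0 \<longrightarrow> r \<bullet> \<zeta> = 0)"
  proof eventually_elim
    case (elim x)
    have low: "norm z \<le> 2 * norm (J x (S z))" for z
    proof -
      have "norm ((J x - J p) (S z)) \<le> norm (J x - J p) * norm (S z)" by (rule norm_blinfun)
      also have "\<dots> \<le> 1 / (2 * N) * (N * norm z)"
        using elim N by (intro mult_mono) (auto simp: dist_norm)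
      also have "\<dots> = norm z / 2" using N(1) by simp
      also have "(J x - J p) (S z) = J x (S z) - z" by (simp add: blinfun.diff_left S(2))
      finally show ?thesis using norm_triangle_ineq2[of z "J x (S z)"] by (simp add: norm_minus_commute)
    qed
    have lin: "linear (\<lambda>z. J x (S z))"
      using linear_compose[OF S(1) bounded_linear.linear[OF blinfun.bounded_linear_right[of "J x"]]] by (simp add: o_def)
    have "inj (\<lambda>z. J x (S z))"
      unfolding linear_injective_0[OF lin] using low by (metis mult_zero_right norm_le_zero_iff norm_zero)
    then have sj: "surj (\<lambda>z. J x (S z))" by (rule linear_inj_imp_surj[OF lin])
    show ?case
    proof
      fix y
      obtain z where z: "J x (S z) = y" using sj by (metis surjD)
      have "N * norm z \<le> N * (2 * norm y)" using low[of z] N(1) unfolding z by (intro mult_left_mono) auto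
      then have "norm (S z) \<le> N * (2 * norm y)" using N(2)[of z] by (rule order_trans[rotated])
      then have "norm (S z) \<le> 2 * N * norm y" by (simp only: mult_ac)
      moreover obtain r where "J x r = y" "norm r \<le> norm (S z)" "\<forall>\<zeta>. J x \<zeta> = 0 \<longrightarrow> r \<bullet> \<zeta> = 0"
        using ex_minimal_norm_preimage[OF bounded_linear.linear[OF blinfun.bounded_linear_right] z] by blast
      ultimately show "\<exists>r. J x r = y \<and> norm r \<le> 2 * N * norm y \<and> (\<forall>\<zeta>. J x \<zeta> = 0 \<longrightarrow> r \<bullet> \<zeta> = 0)"
        by (intro exI[of _ r]) auto
    qed
  qed
  then show ?thesis using N(1) by (intro exI[of _ "2 * N"]) simp
qed

text \<open>By compactness: if no m works, there are unit kernel vectors at points tending to p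
  whose form values are below arbitrarily small positive bounds, and a cluster point contradicts
  positivity at p. Continuity of J puts the cluster point into the kernel at p, so the kernels may
  move with x. The case J = 0 covers forms on the whole space.\<close>

lemma eventually_coercive_on_kernel:
  fixes J :: "'x::metric_space \<Rightarrow> 'a::euclidean_space \<Rightarrow>\<^sub>L 'b::real_normed_vector"
    and B :: "'x \<Rightarrow> 'a \<Rightarrow>\<^sub>L 'a"
  assumes J: "(J \<longlongrightarrow> J p) (nhds p)" and B: "(B \<longlongrightarrow> B p) (nhds p)"
    and pos: "\<And>t. J p t = 0 \<Longrightarrow> t \<noteq> 0 \<Longrightarrow> 0 < B p t \<bullet> t"
  shows "\<exists>m>0. \<forall>\<^sub>F x in nhds p. \<forall>t. J x t = 0 \<longrightarrow> m * (norm t)\<^sup>2 \<le> B x t \<bullet> t"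
proof (rule ccontr)
  assume neg: "\<not> ?thesis"
  have "\<exists>x t. dist x p < inverse (real (Suc n)) \<and> J x t = 0 \<and> norm t = 1 \<and> B x t \<bullet> t < inverse (real (Suc n))" for n
  proof -
    have pos: "0 < inverse (real (Suc n))" by simp
    with neg have "\<not> (\<forall>\<^sub>F x in nhds p. \<forall>t. J x t = 0 \<longrightarrow> inverse (real (Suc n)) * (norm t)\<^sup>2 \<le> B x t \<bullet> t)"
      by blast
    then have "\<exists>x. dist x p < inverse (real (Suc n)) \<and>
        \<not> (\<forall>t. J x t = 0 \<longrightarrow> inverse (real (Suc n)) * (norm t)\<^sup>2 \<le> B x t \<bullet> t)"
      by (rule contrapos_np) (use pos in \<open>simp only: eventually_nhds_metric; metis\<close>)
    then obtain x t where xt: "dist x p < inverse (real (Suc n))" "J x t = 0"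
        "B x t \<bullet> t < inverse (real (Suc n)) * (norm t)\<^sup>2"
      by (auto simp only: not_all not_imp not_le)
    have "t \<noteq> 0" using xt(3) by (auto simp: blinfun.zero_right)
    then have "J x (sgn t) = 0" "norm (sgn t) = 1"
      using xt(2) by (simp_all add: sgn_div_norm blinfun.scaleR_right)
    moreover have "B x (sgn t) \<bullet> sgn t < inverse (real (Suc n))"
    proof -
      have "B x (sgn t) \<bullet> sgn t = B x t \<bullet> t / (norm t)\<^sup>2"
        by (simp add: sgn_div_norm blinfun.scaleR_right blinfun.scaleR_left power2_eq_square divide_inverse)
      then show ?thesis using xt(3) \<open>t \<noteq> 0\<close> by (simp add: pos_divide_less_eq)
    qed
    moreover note xt(1)
    ultimately show ?thesis by blast
  qed
  then obtain X t where Xt: "\<And>n. dist (X n) p < inverse (real (Suc n))" "\<And>n. J (X n) (t n) = 0"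
      "\<And>n. norm (t n) = 1" "\<And>n. B (X n) (t n) \<bullet> t n < inverse (real (Suc n))"
    by metis
  obtain l \<sigma> where l: "l \<in> sphere 0 1" "strict_mono \<sigma>" "(t \<circ> \<sigma>) \<longlonglongrightarrow> (l::'a)"
    using compact_sphere[of "0::'a" 1] Xt(3) unfolding compact_def by (metis dist_0_norm mem_sphere)
  have X: "X \<longlonglongrightarrow> p"
    using LIMSEQ_inverse_real_of_nat Xt(1) by (intro metric_tendsto_imp_tendsto[OF LIMSEQ_inverse_real_of_nat]) (auto intro: always_eventually less_imp_le simp: dist_real_def)
  have XJ: "(J \<circ> X \<circ> \<sigma>) \<longlonglongrightarrow> J p" and XB: "(B \<circ> X \<circ> \<sigma>) \<longlonglongrightarrow> B p"
    using LIMSEQ_subseq_LIMSEQ[OF _ l(2)] filterlim_compose[OF J X] filterlim_compose[OF B X] by (auto simp: o_def)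
  have "(\<lambda>n. J (X (\<sigma> n)) (t (\<sigma> n))) \<longlonglongrightarrow> J p l"
    using blinfun.tendsto[OF XJ l(3)] by (simp add: o_def)
  then have "J p l = 0" using Xt(2) by (simp add: LIMSEQ_const_iff)
  moreover have "(\<lambda>n. B (X (\<sigma> n)) (t (\<sigma> n)) \<bullet> t (\<sigma> n)) \<longlonglongrightarrow> B p l \<bullet> l"
    using tendsto_inner[OF blinfun.tendsto[OF XB l(3)] l(3)] by (simp add: o_def)
  then have "B p l \<bullet> l \<le> 0"
  proof (rule LIMSEQ_le)
    show "(\<lambda>n. inverse (real (Suc (\<sigma> n)))) \<longlonglongrightarrow> 0"
      using LIMSEQ_subseq_LIMSEQ[OF LIMSEQ_inverse_real_of_nat l(2)] by (simp add: o_def)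
    show "\<exists>N. \<forall>n\<ge>N. B (X (\<sigma> n)) (t (\<sigma> n)) \<bullet> t (\<sigma> n) \<le> inverse (real (Suc (\<sigma> n)))"
      using Xt(4) less_imp_le by blast
  qed
  moreover have "l \<noteq> 0" using l(1) by auto
  ultimately show False using pos[of l] by linarith
qed

section \<open>Orthogonal projections and Euclidean gradients\<close>

lemma orth_proj_eqI:
  assumes "subspace T" "p \<in> T" "\<And>\<zeta>. \<zeta> \<in> T \<Longrightarrow> (v - p) \<bullet> \<zeta> = 0"
  shows "orth_proj T v = p"
  unfolding orth_proj_def
proof (rule the_equality)
  show "p \<in> T \<and> v - p \<in> T\<^sup>\<bottom>"
    using assms by (auto simp: orthogonal_comp_def orthogonal_def inner_commute)
  fix q assume q: "q \<in> T \<and> v - q \<in> T\<^sup>\<bottom>"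
  have "q - p \<in> T" using q assms subspace_diff by blast
  then have "(q - p) \<bullet> (v - p) = 0" "(q - p) \<bullet> (v - q) = 0"
    using assms(3) q by (auto simp: orthogonal_comp_def orthogonal_def inner_commute)
  then have "(q - p) \<bullet> (q - p) = 0" by (simp add: inner_diff_right)
  then show "q = p" by simp
qed

lemma orth_proj_in_and_normal:
  fixes T :: "'a::euclidean_space set"
  assumes T: "subspace T"
  shows "orth_proj T v \<in> T" "\<zeta> \<in> T \<Longrightarrow> orth_proj T v \<bullet> \<zeta> = v \<bullet> \<zeta>"
proof -
  obtain q r where *: "q \<in> span T" "\<And>w. w \<in> span T \<Longrightarrow> orthogonal r w" "v = q + r"
    using orthogonal_subspace_decomp_exists[of T v] by blast
  have sp: "span T = T" using T by (simp add: span_eq_iff)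
  have "orth_proj T v = q"
    using * by (intro orth_proj_eqI[OF T]) (auto simp: sp orthogonal_def)
  then show "orth_proj T v \<in> T" "\<zeta> \<in> T \<Longrightarrow> orth_proj T v \<bullet> \<zeta> = v \<bullet> \<zeta>"
    using * by (auto simp: sp orthogonal_def inner_add_left)
qed

lemma linear_orth_proj:
  assumes T: "subspace T"
  shows "linear (orth_proj T)"
  by (rule linearI; intro orth_proj_eqI[OF T] subspace_add[OF T] subspace_mul[OF T])
    (auto simp: orth_proj_in_and_normal[OF T] inner_diff_left inner_add_left)

lemma bij_betw_linear_subspace:
  fixes h :: "'a::euclidean_space \<Rightarrow> 'a"
  assumes h: "linear h" and T: "subspace T" and into: "h ` T \<subseteq> T"
    and inj: "\<And>t. t \<in> T \<Longrightarrow> h t = 0 \<Longrightarrow> t = 0"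
  shows "bij_betw h T T"
proof -
  have i: "inj_on h T"
    using inj by (simp add: linear_inj_on_iff_eq_0[OF h] T span_eq_iff[THEN iffD2])
  then have "dim (h ` T) = dim T"
    using T by (intro dim_image_eq[OF h]) (simp add: span_eq_iff[THEN iffD2])
  then have "h ` T = T"
    using subspace_dim_equal[OF linear_subspace_image[OF h T] T into] by simp
  with i show ?thesis by (simp add: bij_betw_def)
qed

text \<open>The Riesz vector in coordinates. It is linear in D, so gradients can be differentiated
  coefficient by coefficient.\<close>

lemma linear_functional_representative:
  fixes D :: "'a::euclidean_space \<Rightarrow> real"
  assumes "linear D"
  shows "(\<Sum>b\<in>Basis. D b *\<^sub>R b) \<bullet> \<zeta> = D \<zeta>"
proof -
  have "D \<zeta> = D (\<Sum>b\<in>Basis. (\<zeta> \<bullet> b) *\<^sub>R b)" by (simp add: euclidean_representation)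
  also have "\<dots> = (\<Sum>b\<in>Basis. (\<zeta> \<bullet> b) * D b)" by (simp add: linear_sum[OF assms] linear_cmul[OF assms])
  also have "\<dots> = (\<Sum>b\<in>Basis. D b *\<^sub>R b) \<bullet> \<zeta>"
    unfolding inner_sum_left by (intro sum.cong) (simp_all add: inner_commute[of \<zeta>])
  finally show ?thesis by simp
qed

lemma GDERIV_representative:
  fixes D :: "'a::euclidean_space \<Rightarrow> real"
  assumes D: "(h has_derivative D) (at x)"
  shows "GDERIV h x :> (\<Sum>b\<in>Basis. D b *\<^sub>R b)"
  using D linear_functional_representative[OF has_derivative_linear[OF D]]
  unfolding gderiv_def by (simp add: inner_commute)

lemma egrad_eq:
  fixes D :: "'a::euclidean_space \<Rightarrow> real"
  assumes D: "(h has_derivative D) (at x)"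
  shows "egrad h x = (\<Sum>b\<in>Basis. D b *\<^sub>R b)"
  unfolding egrad_def
proof (rule the_equality[where P="\<lambda>v. GDERIV h x :> v", OF GDERIV_representative[OF D]])
  show "v = (\<Sum>b\<in>Basis. D b *\<^sub>R b)" if "GDERIV h x :> v" for v
  proof -
    have "(\<lambda>h. h \<bullet> v) = D" using that D has_derivative_unique unfolding gderiv_def by blast
    then have "D b = v \<bullet> b" for b by (metis inner_commute)
    then show ?thesis by (simp add: euclidean_representation)
  qed
qed

lemma egrad_inner:
  fixes D :: "'a::euclidean_space \<Rightarrow> real"
  assumes D: "(h has_derivative D) (at x)"
  shows "egrad h x \<bullet> \<zeta> = D \<zeta>"
  unfolding egrad_eq[OF D] by (rule linear_functional_representative[OF has_derivative_linear[OF D]])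

section \<open>Least-squares multiplier and pseudoinverse for the metric\<close>

lemma inj_adjoint_of_surj:
  fixes J :: "'a::euclidean_space \<Rightarrow> 'b::euclidean_space"
  assumes "linear J" "surj J" "adjoint J \<mu> = 0"
  shows "\<mu> = 0"
proof -
  obtain r where "J r = \<mu>" using assms(2) by (metis surjD)
  then have "\<mu> \<bullet> \<mu> = 0" using adjoint_works[OF assms(1), of r \<mu>] assms(3) by (metis inner_zero_right)
  then show ?thesis by simp
qed

text \<open>The quadratic form of \<open>J \<circ> adjoint J\<close> is the squared norm of
  \<open>adjoint J \<mu>\<close>, so the \<open>inv\<close> in the multiplier is a true inverse and
  the normal equation holds. It says that the residual is tangent.\<close>

lemma ls_multiplier_residual:
  fixes f :: "'a::euclidean_space \<Rightarrow> real" and c :: "'a \<Rightarrow> 'b::euclidean_space"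
  assumes c: "(c has_derivative J) (at x)" and sj: "surj J"
  shows "J (egrad f x - adjoint J (ls_multiplier f c x)) = 0"
proof -
  have lin: "linear J" using c by (rule has_derivative_linear)
  have linJ: "linear (J \<circ> adjoint J)" by (rule linear_compose[OF adjoint_linear[OF lin] lin])
  have "inj (J \<circ> adjoint J)"
    unfolding linear_injective_0[OF linJ]
  proof (intro allI impI)
    fix \<mu> assume "(J \<circ> adjoint J) \<mu> = 0"
    then have "adjoint J \<mu> \<bullet> adjoint J \<mu> = 0" using adjoint_works[OF lin, of "adjoint J \<mu>" \<mu>] by simp
    then show "\<mu> = 0" using inj_adjoint_of_surj[OF lin sj] by simp
  qed
  then have "surj (J \<circ> adjoint J)" by (rule linear_inj_imp_surj[OF linJ])
  then have "(J \<circ> adjoint J) (ls_multiplier f c x) = J (egrad f x)"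
    unfolding ls_multiplier_def frechet_derivative_at[OF c, symmetric] by (rule surj_f_inv_f)
  then show ?thesis by (simp add: linear_diff[OF lin])
qed

lemma bij_of_positive_definite:
  fixes g :: "'a::euclidean_space \<Rightarrow>\<^sub>L 'a"
  assumes "\<And>u. u \<noteq> 0 \<Longrightarrow> 0 < g u \<bullet> u"
  shows "bij (blinfun_apply g)"
proof -
  have lin: "linear (blinfun_apply g)" by (rule bounded_linear.linear[OF blinfun.bounded_linear_right])
  have "inj (blinfun_apply g)"
    unfolding linear_injective_0[OF lin] using assms by (metis inner_zero_left less_irrefl)
  then show ?thesis using linear_inj_imp_surj[OF lin] by (simp add: bij_def)
qed

text \<open>The quadratic form of \<open>J \<circ> adjoint_g c G x\<close> at \<mu> is the squared
  g-norm of \<open>adjoint_g c G x \<mu>\<close>, which vanishes only for \<mu> = 0. The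
  orthogonality holds because \<open>G x\<close> carries the range of \<open>pinv_g\<close> into
  that of \<open>adjoint J\<close>, which is orthogonal to the kernel of J.\<close>

lemma bij_and_pinv_g:
  fixes c :: "'a::euclidean_space \<Rightarrow> 'b::euclidean_space" and G :: "'a \<Rightarrow> 'a \<Rightarrow>\<^sub>L 'a"
  assumes c: "(c has_derivative J) (at x)" and sj: "surj J"
    and pos: "\<And>u. u \<noteq> 0 \<Longrightarrow> 0 < G x u \<bullet> u"
  shows "bij (J \<circ> adjoint_g c G x)" "J (pinv_g c G x y) = y"
    "J \<zeta> = 0 \<Longrightarrow> G x (pinv_g c G x y) \<bullet> \<zeta> = 0"
proof -
  have lin: "linear J" using c by (rule has_derivative_linear)
  have bG: "bij (blinfun_apply (G x))" using pos by (rule bij_of_positive_definite)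
  have linG: "linear (blinfun_apply (G x))" by (rule bounded_linear.linear[OF blinfun.bounded_linear_right])
  have Gi: "G x (inv (blinfun_apply (G x)) u) = u" for u using bG by (simp add: bij_def surj_f_inv_f)
  have linGi: "linear (inv (blinfun_apply (G x)))"
    using inj_linear_imp_inv_linear[OF linG] bG by (simp add: bij_def)
  have a: "adjoint_g c G x = inv (blinfun_apply (G x)) \<circ> adjoint J"
    unfolding adjoint_g_def frechet_derivative_at[OF c, symmetric] ..
  have Ga: "G x (adjoint_g c G x \<mu>) = adjoint J \<mu>" for \<mu> unfolding a by (simp add: Gi)
  have linK: "linear (J \<circ> adjoint_g c G x)"
    unfolding a by (intro linear_compose[OF _ lin] linear_compose[OF adjoint_linear[OF lin] linGi])
  have "inj (J \<circ> adjoint_g c G x)"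
    unfolding linear_injective_0[OF linK]
  proof (intro allI impI)
    fix \<mu> assume "(J \<circ> adjoint_g c G x) \<mu> = 0"
    then have "G x (adjoint_g c G x \<mu>) \<bullet> adjoint_g c G x \<mu> = 0"
      unfolding Ga using adjoint_works[OF lin, of "adjoint_g c G x \<mu>" \<mu>] by (simp add: inner_commute)
    then have "adjoint_g c G x \<mu> = 0" using pos by (metis less_irrefl)
    then have "adjoint J \<mu> = 0" using Ga[of \<mu>] by (simp add: blinfun.zero_right)
    then show "\<mu> = 0" by (rule inj_adjoint_of_surj[OF lin sj])
  qed
  then show bij: "bij (J \<circ> adjoint_g c G x)"
    using linear_inj_imp_surj[OF linK] by (simp add: bij_def)
  then have "(J \<circ> adjoint_g c G x) (inv (J \<circ> adjoint_g c G x) y) = y"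
    by (simp only: bij_is_surj surj_f_inv_f)
  then show "J (pinv_g c G x y) = y"
    unfolding pinv_g_def frechet_derivative_at[OF c, symmetric] by simp
  show "G x (pinv_g c G x y) \<bullet> \<zeta> = 0" if "J \<zeta> = 0"
    unfolding pinv_g_def comp_apply Ga
    using that adjoint_works[OF lin, of \<zeta>] by (metis inner_commute inner_zero_left)
qed

section \<open>Saddle point system and first-order optimality\<close>

text \<open>The saddle point matrix with blocks g, transpose of J, J and 0. The sum is the adjoint
  of J applied to the multiplier, written in coordinates so that its dependence on J is visibly
  linear.\<close>

definition kkt :: "('a::euclidean_space \<Rightarrow>\<^sub>L 'a) \<Rightarrow> ('a \<Rightarrow>\<^sub>L 'b::euclidean_space) \<Rightarrow> 'a \<times> 'b \<Rightarrow> 'a \<times> 'b" where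
  "kkt g J z = (g (fst z) + (\<Sum>b\<in>Basis. (snd z \<bullet> J b) *\<^sub>R b), J (fst z))"

lemma kkt_eq_iff:
  fixes D :: "'a::euclidean_space \<Rightarrow> real"
  assumes D: "linear D"
  shows "kkt g J z = (\<Sum>b\<in>Basis. D b *\<^sub>R b, 0) \<longleftrightarrow>
     J (fst z) = 0 \<and> (\<forall>\<zeta>. g (fst z) \<bullet> \<zeta> + snd z \<bullet> J \<zeta> = D \<zeta>)"
proof -
  let ?S = "\<Sum>b\<in>Basis. (snd z \<bullet> J b) *\<^sub>R b" and ?R = "\<Sum>b\<in>Basis. D b *\<^sub>R b"
  have "linear (\<lambda>u. snd z \<bullet> J u)"
    by (rule bounded_linear.linear) (auto intro!: bounded_linear_intros)
  note S = linear_functional_representative[OF this] and R = linear_functional_representative[OF D]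
  have "g (fst z) + ?S = ?R \<longleftrightarrow> (\<forall>\<zeta>. (g (fst z) + ?S) \<bullet> \<zeta> = ?R \<bullet> \<zeta>)"
    using vector_eq_rdot by blast
  then show ?thesis unfolding kkt_def prod.inject inner_add_left S R by auto
qed

lemma linear_kkt: "linear (kkt g J)"
  unfolding kkt_def
  by (rule linearI)
    (auto simp: blinfun.add_right blinfun.scaleR_right inner_add_left scaleR_add_left sum.distrib
      scaleR_add_right scaleR_sum_right)

lemma inj_kkt:
  fixes g :: "'a::euclidean_space \<Rightarrow>\<^sub>L 'a" and J :: "'a \<Rightarrow>\<^sub>L 'b::euclidean_space"
  assumes pos: "\<And>u. u \<noteq> 0 \<Longrightarrow> 0 < g u \<bullet> u" and sj: "surj (blinfun_apply J)"
  shows "inj (kkt g J)"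
  unfolding linear_injective_0[OF linear_kkt]
proof (intro allI impI)
  fix z assume "kkt g J z = 0"
  then have z: "J (fst z) = 0" "\<And>\<zeta>. g (fst z) \<bullet> \<zeta> + snd z \<bullet> J \<zeta> = 0"
    using kkt_eq_iff[of "\<lambda>_. 0" g J z] by (auto simp: linear_zero zero_prod_def)
  then have "g (fst z) \<bullet> fst z = 0" using z(2)[of "fst z"] by simp
  then have f: "fst z = 0" using pos by (metis less_irrefl)
  obtain r where "J r = snd z" using sj by (metis surjD)
  then have "snd z \<bullet> snd z = 0" using z(2)[of r] f by (simp add: blinfun.zero_right)
  with f show "z = 0" by (simp add: prod_eq_iff)
qed

text \<open>If \<open>f' \<zeta>\<close> were nonzero, the pair (f, c) would have a surjective
  derivative at p. By the open mapping property it would then take the value (f p - d / 2, 0) near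
  p, against minimality. No curves in the constraint set have to be constructed.\<close>

lemma lagrange_first_order:
  fixes f :: "'a::euclidean_space \<Rightarrow> real" and c :: "'a \<Rightarrow> 'b::euclidean_space"
  assumes min: "constrained_local_min f c p"
    and contf: "continuous_on UNIV f" and contc: "continuous_on UNIV c"
    and f: "(f has_derivative f') (at p)" and c: "(c has_derivative J) (at p)"
    and sj: "surj J" and \<zeta>: "J \<zeta> = 0"
  shows "f' \<zeta> = 0"
proof (rule ccontr)
  assume nz: "f' \<zeta> \<noteq> 0"
  have lin: "linear J" "linear f'" using c f by (auto intro: has_derivative_linear)
  obtain e where e: "0 < e" "\<And>y. y \<in> ball p e \<Longrightarrow> c y = 0 \<Longrightarrow> f p \<le> f y" and cp: "c p = 0"
    using min unfolding constrained_local_min_def by blast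
  have F: "((\<lambda>y. (f y, c y)) has_derivative (\<lambda>h. (f' h, J h))) (at p)"
    by (intro has_derivative_Pair f c)
  have "surj (\<lambda>h. (f' h, J h))"
    unfolding surj_def
  proof
    fix z :: "real \<times> 'b"
    obtain r where r: "J r = snd z" using sj by (metis surjD)
    \<comment> \<open>A multiple of \<zeta> corrects the first component; the second is unaffected
      since \<zeta> lies in the kernel of J.\<close>
    have "(f' (r + ((fst z - f' r) / f' \<zeta>) *\<^sub>R \<zeta>), J (r + ((fst z - f' r) / f' \<zeta>) *\<^sub>R \<zeta>)) = z"
      using nz r \<zeta> by (simp add: lin linear_add linear_cmul prod_eq_iff)
    then show "\<exists>h. z = (f' h, J h)" by metis
  qed
  then obtain R where R: "linear R" "(\<lambda>h. (f' h, J h)) \<circ> R = id"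
    using linear_surjective_right_inverse[OF has_derivative_linear[OF F]] by blast
  have "(f p, c p) \<in> interior ((\<lambda>y. (f y, c y)) ` ball p e)"
    by (rule sussmann_open_mapping[where S=UNIV, OF _ _ _ F _ R(2)])
      (use R e in \<open>auto simp: linear_conv_bounded_linear intro!: continuous_on_Pair contf contc\<close>)
  then obtain d where d: "0 < d" "ball (f p, c p) d \<subseteq> (\<lambda>y. (f y, c y)) ` ball p e"
    unfolding mem_interior by blast
  have "(f p - d / 2, c p) \<in> ball (f p, c p) d" using d(1) by (simp add: dist_Pair_Pair dist_real_def)
  then obtain y where "y \<in> ball p e" "f y = f p - d / 2" "c y = 0" using d(2) cp by auto
  then show False using e(2)[of y] d(1) by simp
qed

text \<open>The multiplier is a constant l during differentiation, so near x the gradient of the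
  Lagrangian is an explicit coordinate sum in \<open>f'\<close> and \<open>c'\<close>, and its
  derivative contains no term from a varying multiplier.\<close>

lemma lagrangian_hess_inner:
  fixes f :: "'a::euclidean_space \<Rightarrow> real" and c :: "'a \<Rightarrow> 'b::euclidean_space"
    and c' :: "'a \<Rightarrow> 'a \<Rightarrow>\<^sub>L 'b" and f' :: "'a \<Rightarrow> 'a \<Rightarrow>\<^sub>L real"
  assumes c: "\<forall>\<^sub>F y in nhds x. (c has_derivative c' y) (at y)" and c': "(c' has_derivative c'') (at x)"
    and f: "\<forall>\<^sub>F y in nhds x. (f has_derivative f' y) (at y)" and f': "(f' has_derivative f'') (at x)"
  shows "lagrangian_hess f c x \<xi> \<bullet> \<zeta> = f'' \<xi> \<zeta> - ls_multiplier f c x \<bullet> c'' \<xi> \<zeta>"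
proof -
  define l where "l = ls_multiplier f c x"
  define g where "g y = (\<Sum>b\<in>Basis. (f' y b - l \<bullet> c' y b) *\<^sub>R b)" for y
  have "\<forall>\<^sub>F y in nhds x. egrad (lagrangian f c l) y = g y"
    using c f
  proof eventually_elim
    case (elim y)
    have "(lagrangian f c l has_derivative (\<lambda>h. f' y h - l \<bullet> c' y h)) (at y)"
      unfolding lagrangian_def[abs_def] using elim by (auto intro!: derivative_eq_intros)
    then show ?case unfolding g_def by (rule egrad_eq)
  qed
  note ev = this
  have app: "((\<lambda>y. blinfun_apply (h y) b) has_derivative (\<lambda>\<xi>. blinfun_apply (h' \<xi>) b)) (at x)"
    if "(h has_derivative h') (at x)" for h :: "'a \<Rightarrow> 'a \<Rightarrow>\<^sub>L 'z::real_normed_vector" and h' b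
    by (rule bounded_linear.has_derivative[OF blinfun.bounded_linear_left that])
  have "(g has_derivative (\<lambda>\<xi>. \<Sum>b\<in>Basis. (f'' \<xi> b - l \<bullet> c'' \<xi> b) *\<^sub>R b)) (at x)"
    unfolding g_def[abs_def]
    by (auto intro!: derivative_eq_intros app f' c')
  then have "(egrad (lagrangian f c l) has_derivative (\<lambda>\<xi>. \<Sum>b\<in>Basis. (f'' \<xi> b - l \<bullet> c'' \<xi> b) *\<^sub>R b)) (at x)"
    by (rule has_derivative_transform_eventually)
      (use ev eventually_nhds_x_imp_x[OF ev] in \<open>auto simp: eventually_at_filter elim: eventually_mono\<close>)
  from frechet_derivative_at[OF this, symmetric]
  have "lagrangian_hess f c x \<xi> = (\<Sum>b\<in>Basis. (f'' \<xi> b - l \<bullet> c'' \<xi> b) *\<^sub>R b)"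
    unfolding lagrangian_hess_def ehess_def l_def[symmetric] by (rule fun_cong)
  also have "\<dots> \<bullet> \<zeta> = f'' \<xi> \<zeta> - l \<bullet> c'' \<xi> \<zeta>"
  proof -
    have "linear (\<lambda>u. f'' \<xi> u - l \<bullet> c'' \<xi> u)"
      by (rule bounded_linear.linear) (auto intro!: bounded_linear_intros)
    then show ?thesis by (rule linear_functional_representative)
  qed
  finally show ?thesis unfolding l_def .
qed

text \<open>The bound on \<gamma> * \<delta> turns the quadratic estimate into a halving of the
  error, which keeps the iterates in the ball where the estimate holds.\<close>

lemma quadratic_iteration_converges:
  fixes x :: "nat \<Rightarrow> 'a::real_normed_vector"
  assumes \<gamma>: "0 < \<gamma>" and \<delta>: "\<gamma> * \<delta> \<le> 1 / 2" and x0: "norm (x 0 - p) < \<delta>"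
    and step: "\<And>k. norm (x k - p) < \<delta> \<Longrightarrow> norm (x (Suc k) - p) \<le> \<gamma> * (norm (x k - p))\<^sup>2"
  shows "\<And>k. norm (x k - p) < \<delta>" "x \<longlonglongrightarrow> p"
proof -
  have *: "norm (x k - p) < \<delta> \<and> norm (x k - p) \<le> \<delta> * (1 / 2) ^ k" for k
  proof (induction k)
    case 0 then show ?case using x0 by simp
  next
    case (Suc k)
    have "norm (x (Suc k) - p) \<le> (\<gamma> * norm (x k - p)) * norm (x k - p)"
      using step Suc by (simp add: power2_eq_square mult.assoc)
    moreover have "\<gamma> * norm (x k - p) \<le> \<gamma> * \<delta>" using Suc \<gamma> by (intro mult_left_mono) auto
    with \<delta> have "(\<gamma> * norm (x k - p)) * norm (x k - p) \<le> 1 / 2 * norm (x k - p)"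
      by (intro mult_right_mono) auto
    ultimately have h: "norm (x (Suc k) - p) \<le> norm (x k - p) / 2" by simp
    have "norm (x k - p) / 2 \<le> norm (x k - p)" by simp
    with h Suc have "norm (x (Suc k) - p) < \<delta>" by linarith
    with h Suc show ?case by auto
  qed
  then show "norm (x k - p) < \<delta>" for k by blast
  have "(\<lambda>k. \<delta> * (1 / 2) ^ k) \<longlonglongrightarrow> \<delta> * 0" by (intro tendsto_intros LIMSEQ_power_zero) auto
  then have "(\<lambda>k. x k - p) \<longlonglongrightarrow> 0"
    using * by (intro Lim_null_comparison[of "\<lambda>k. x k - p" "\<lambda>k. \<delta> * (1 / 2) ^ k"] always_eventually allI)
      simp_all
  then show "x \<longlonglongrightarrow> p" by (simp add: LIM_zero_iff)
qed

text \<open>The derivative is frozen at x rather than at p because the Newton system is formed at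
  the iterate.\<close>

lemma linearization_at_endpoint:
  fixes h :: "'a::real_normed_vector \<Rightarrow> 'b::real_normed_vector"
  assumes h: "\<And>y. y \<in> closed_segment p x \<Longrightarrow> (h has_derivative blinfun_apply (h' y)) (at y)"
    and B: "\<And>y. y \<in> closed_segment p x \<Longrightarrow> norm (h' y - h' x) \<le> B"
  shows "norm (h x - h p - h' x (x - p)) \<le> norm (x - p) * B"
proof (rule differentiable_bound_linearization[where S="closed_segment p x"])
  show "p + t *\<^sub>R (x - p) \<in> closed_segment p x" if "t \<in> {0..1}" for t
    using that by (auto simp: in_segment algebra_simps intro!: exI[of _ t])
  show "(h has_derivative h' y) (at y within closed_segment p x)" if "y \<in> closed_segment p x" for y
    using h[OF that] by (rule has_derivative_at_withinI)
  show "onorm (blinfun_apply (h' y) - blinfun_apply (h' x)) \<le> B" if "y \<in> closed_segment p x" for y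
    using B[OF that] by (simp add: norm_blinfun.rep_eq minus_blinfun.rep_eq fun_diff_def)
qed simp

lemma norm_blinfun2: "norm (blinfun_apply (blinfun_apply B a) b) \<le> norm B * norm a * norm b"
  by (meson mult_right_mono norm_blinfun norm_ge_zero order_trans)

text \<open>Cancels one norm in coercivity estimates
  \<open>(norm t)\<^sup>2 \<le> k * norm t\<close>, with t = 0 included.\<close>

lemma le_of_power2_le_mult:
  fixes a :: real
  assumes "a\<^sup>2 \<le> k * a" "0 \<le> k"
  shows "a \<le> k"
  using assms by (cases "a \<le> 0") (auto simp: power2_eq_square)

lemma tendsto_imp_eventually_norm_bounded:
  fixes h :: "'x::topological_space \<Rightarrow> 'b::real_normed_vector"
  assumes "(h \<longlongrightarrow> l) F"
  shows "\<exists>C>0. \<forall>\<^sub>F x in F. norm (h x) \<le> C"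
proof -
  have "\<forall>\<^sub>F x in F. dist (h x) l < 1" using assms by (rule tendstoD) simp
  then have "\<forall>\<^sub>F x in F. norm (h x) \<le> norm l + 1"
  proof eventually_elim
    case (elim x)
    then show ?case using norm_triangle_ineq2[of "h x" l] by (simp add: dist_norm)
  qed
  then show ?thesis by (intro exI[of _ "norm l + 1"]) (simp add: add_nonneg_pos)
qed

lemma eventually_mult_norm_le:
  fixes p :: "'a::real_normed_vector"
  assumes "0 < m"
  shows "\<forall>\<^sub>F x in nhds p. C * norm (x - p) \<le> m"
proof -
  have "((\<lambda>x. C * norm (x - p)) \<longlongrightarrow> C * norm (p - p)) (nhds p)"
    by (intro tendsto_intros filterlim_ident)
  from order_tendstoD(2)[OF this, of m] assms show ?thesis by (auto elim: eventually_mono)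
qed

section \<open>Estimates for the Lagrangian near the minimizer\<close>

text \<open>The witnesses of the regularity assumptions become parameters on one common ball, so
  that the derivative fields have names. The estimates are stated for x eventually near p, which
  spares the bookkeeping of radii.\<close>

locale newton_landing =
  fixes f :: "'a::euclidean_space \<Rightarrow> real"
    and c :: "'a \<Rightarrow> 'b::euclidean_space"
    and G :: "'a \<Rightarrow> 'a \<Rightarrow>\<^sub>L 'a"
    and A :: "'a \<Rightarrow> 'a \<Rightarrow>\<^sub>L 'a \<Rightarrow>\<^sub>L 'a"
    and p :: 'a
    and \<epsilon> Lc Lf :: real
    and c' :: "'a \<Rightarrow> 'a \<Rightarrow>\<^sub>L 'b" and c'' :: "'a \<Rightarrow> 'a \<Rightarrow>\<^sub>L 'a \<Rightarrow>\<^sub>L 'b"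
    and f' :: "'a \<Rightarrow> 'a \<Rightarrow>\<^sub>L real" and f'' :: "'a \<Rightarrow> 'a \<Rightarrow>\<^sub>L 'a \<Rightarrow>\<^sub>L real"
    and G' :: "'a \<Rightarrow> 'a \<Rightarrow>\<^sub>L 'a \<Rightarrow>\<^sub>L 'a"
  assumes \<epsilon>: "0 < \<epsilon>"
    and c_deriv: "\<And>x. x \<in> ball p \<epsilon> \<Longrightarrow> (c has_derivative c' x) (at x)"
    and c'_deriv: "\<And>x. x \<in> ball p \<epsilon> \<Longrightarrow> (c' has_derivative c'' x) (at x)"
    and c''_lipschitz: "Lc-lipschitz_on (ball p \<epsilon>) c''"
    and f_deriv: "\<And>x. x \<in> ball p \<epsilon> \<Longrightarrow> (f has_derivative f' x) (at x)"
    and f'_deriv: "\<And>x. x \<in> ball p \<epsilon> \<Longrightarrow> (f' has_derivative f'' x) (at x)"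
    and f''_lipschitz: "Lf-lipschitz_on (ball p \<epsilon>) f''"
    and contc: "continuous_on UNIV c" and contf: "continuous_on UNIV f"
    and G_deriv: "\<And>x. (G has_derivative G' x) (at x)"
    and G'_cont: "continuous_on UNIV G'"
    and G_pos: "\<And>x u. u \<noteq> 0 \<Longrightarrow> gmetric G x u u > 0"
    and conn: "connection_field c A"
    and regular: "p \<in> regular_points c"
    and min: "constrained_local_min f c p"
    and hess_pos: "\<And>\<xi>. \<xi> \<in> tangent c p \<Longrightarrow> \<xi> \<noteq> 0 \<Longrightarrow> riem_hess_E f c p \<xi> \<bullet> \<xi> > 0"
    and normal: "\<forall>\<^sub>F x in nhds p. g_normal_space c G x = (lagrangian_hess f c x ` tangent c x)\<^sup>\<bottom>"
begin

abbreviation lam :: "'a \<Rightarrow> 'b" where "lam \<equiv> ls_multiplier f c"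
abbreviation Lh :: "'a \<Rightarrow> 'a \<Rightarrow> 'a" where "Lh \<equiv> lagrangian_hess f c"

lemma ev_ball: "\<forall>\<^sub>F x in nhds p. x \<in> ball p \<epsilon>"
  using \<epsilon> by (intro eventually_nhds_in_open) auto

lemma p_ball [simp]: "p \<in> ball p \<epsilon>" using \<epsilon> by simp

lemma tangent_iff: "x \<in> ball p \<epsilon> \<Longrightarrow> \<zeta> \<in> tangent c x \<longleftrightarrow> c' x \<zeta> = 0"
  unfolding tangent_def using frechet_derivative_at[OF c_deriv] by simp

lemma subspace_tangent: "x \<in> ball p \<epsilon> \<Longrightarrow> subspace (tangent c x)"
  by (auto simp: subspace_def tangent_iff blinfun.zero_right blinfun.add_right blinfun.scaleR_right)

lemma regular_iff: "x \<in> ball p \<epsilon> \<Longrightarrow> x \<in> regular_points c \<longleftrightarrow> surj (blinfun_apply (c' x))"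
proof -
  assume x: "x \<in> ball p \<epsilon>"
  have "Dv c x = c' x" using frechet_derivative_at[OF c_deriv[OF x]] by simp
  moreover have "subspace (range (blinfun_apply (c' x)))"
    by (rule linear_subspace_image[OF bounded_linear.linear[OF blinfun.bounded_linear_right] subspace_UNIV])
  ultimately show ?thesis
    unfolding regular_points_def mem_Collect_eq by (simp add: dim_eq_full span_eq_iff[THEN iffD2])
qed

lemma c'_tendsto: "(c' \<longlongrightarrow> c' p) (nhds p)"
  using has_derivative_continuous[OF c'_deriv[OF p_ball]] by (simp add: isCont_def tendsto_at_iff_tendsto_nhds)

lemma c''_tendsto: "(c'' \<longlongrightarrow> c'' p) (nhds p)"
  using lipschitz_on_continuous_on[OF c''_lipschitz] p_ball
  by (metis continuous_on_eq_continuous_at isCont_def open_ball tendsto_at_iff_tendsto_nhds)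

lemma f''_tendsto: "(f'' \<longlongrightarrow> f'' p) (nhds p)"
  using lipschitz_on_continuous_on[OF f''_lipschitz] p_ball
  by (metis continuous_on_eq_continuous_at isCont_def open_ball tendsto_at_iff_tendsto_nhds)

lemma G_tendsto: "(G \<longlongrightarrow> G p) (nhds p)"
  using has_derivative_continuous[OF G_deriv] by (simp add: isCont_def tendsto_at_iff_tendsto_nhds)

lemma G'_tendsto: "(G' \<longlongrightarrow> G' p) (nhds p)"
  using G'_cont by (metis UNIV_I continuous_on_eq_continuous_at isCont_def open_UNIV tendsto_at_iff_tendsto_nhds)

lemma surj_p: "surj (blinfun_apply (c' p))"
  using regular regular_iff[OF p_ball] by blast

lemma right_inverse_bound:
  "\<exists>C>0. \<forall>\<^sub>F x in nhds p. \<forall>y. \<exists>r. c' x r = y \<and> norm r \<le> C * norm y \<and> (\<forall>\<zeta>. c' x \<zeta> = 0 \<longrightarrow> r \<bullet> \<zeta> = 0)"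
  by (rule eventually_bounded_right_inverse[OF c'_tendsto surj_p])

lemma ev_surj: "\<forall>\<^sub>F x in nhds p. surj (blinfun_apply (c' x))"
proof -
  obtain C where "\<forall>\<^sub>F x in nhds p. \<forall>y. \<exists>r. c' x r = y \<and> norm r \<le> C * norm y \<and> (\<forall>\<zeta>. c' x \<zeta> = 0 \<longrightarrow> r \<bullet> \<zeta> = 0)"
    using right_inverse_bound by blast
  then show ?thesis by eventually_elim (metis surjI)
qed

lemma ev_regular: "\<forall>\<^sub>F x in nhds p. x \<in> regular_points c"
  using ev_ball ev_surj by eventually_elim (simp add: regular_iff)

text \<open>\<open>A\<close> is continuous only relative to the regular points;
  \<open>ev_regular\<close> makes that set a neighbourhood of p.\<close>

lemma A_bound: "\<exists>C>0. \<forall>\<^sub>F x in nhds p. norm (A x) \<le> C"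
proof -
  have "continuous_on (regular_points c) A" using conn by (simp add: connection_field_def)
  then obtain d where d: "0 < d" "\<forall>x\<in>regular_points c. dist x p < d \<longrightarrow> dist (A x) (A p) < 1"
    using regular unfolding continuous_on_iff by (metis zero_less_one)
  have "\<forall>\<^sub>F x in nhds p. dist x p < d" using d(1) by (auto simp: eventually_nhds_metric)
  with ev_regular have "\<forall>\<^sub>F x in nhds p. norm (A x) \<le> norm (A p) + 1"
  proof eventually_elim
    case (elim x)
    then have "dist (A x) (A p) < 1" using d(2) by blast
    then show ?case using norm_triangle_ineq2[of "A x" "A p"] by (simp add: dist_norm)
  qed
  then show ?thesis by (intro exI[of _ "norm (A p) + 1"]) (simp add: add_nonneg_pos)
qed

lemma G_coercive: "\<exists>m>0. \<forall>\<^sub>F x in nhds p. \<forall>t. m * (norm t)\<^sup>2 \<le> G x t \<bullet> t"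
  using eventually_coercive_on_kernel[of "\<lambda>_. 0 :: 'a \<Rightarrow>\<^sub>L 'a" p G, OF tendsto_const G_tendsto] G_pos
  by (simp add: gmetric_def)

lemma Lh_inner: "x \<in> ball p \<epsilon> \<Longrightarrow> Lh x \<xi> \<bullet> \<zeta> = f'' x \<xi> \<zeta> - lam x \<bullet> c'' x \<xi> \<zeta>"
proof -
  assume x: "x \<in> ball p \<epsilon>"
  have "\<forall>\<^sub>F y in nhds x. y \<in> ball p \<epsilon>" using x by (intro eventually_nhds_in_open) auto
  then show ?thesis
    by (intro lagrangian_hess_inner[where c=c and c'=c' and f=f and f'=f'] c'_deriv f'_deriv x)
      (auto elim!: eventually_mono intro: c_deriv f_deriv)
qed

lemma Lh_symmetric:
  assumes x: "x \<in> ball p \<epsilon>"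
  shows "Lh x \<xi> \<bullet> \<zeta> = Lh x \<zeta> \<bullet> \<xi>"
proof -
  obtain r where r: "0 < r" "ball x r \<subseteq> ball p \<epsilon>"
    using x open_contains_ball[of "ball p \<epsilon>"] open_ball by blast
  have "c'' x \<xi> \<zeta> = c'' x \<zeta> \<xi>"
    by (rule symmetric_second_derivative[where h=c and h'=c', OF _ c'_deriv[OF x] r(1)]) (use r c_deriv in auto)
  moreover have "f'' x \<xi> \<zeta> = f'' x \<zeta> \<xi>"
    by (rule symmetric_second_derivative[where h=f and h'=f', OF _ f'_deriv[OF x] r(1)]) (use r f_deriv in auto)
  ultimately show ?thesis by (simp add: Lh_inner[OF x])
qed

section \<open>Multiplier estimates at the minimizer\<close>

text \<open>The vector w is the Riemannian gradient for the Euclidean metric. Being tangent, it is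
  orthogonal to every r normal to the kernel, so \<open>f' x r = lam x \<bullet> c' x r\<close>
  along such r.\<close>

lemma residual:
  assumes x: "x \<in> ball p \<epsilon>" and sj: "surj (blinfun_apply (c' x))"
  shows "\<exists>w. c' x w = 0 \<and> (\<forall>\<zeta>. w \<bullet> \<zeta> = f' x \<zeta> - lam x \<bullet> c' x \<zeta>)"
proof (intro exI conjI allI)
  let ?w = "egrad f x - adjoint (c' x) (lam x)"
  show "c' x ?w = 0" by (rule ls_multiplier_residual[OF c_deriv[OF x] sj])
  show "?w \<bullet> \<zeta> = f' x \<zeta> - lam x \<bullet> c' x \<zeta>" for \<zeta>
    using adjoint_works[OF has_derivative_linear[OF c_deriv[OF x]], of \<zeta> "lam x"]
    by (simp add: inner_diff_left egrad_inner[OF f_deriv[OF x]] inner_commute[of "adjoint (c' x) (lam x)"] inner_commute[of "lam x"])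
qed

text \<open>The residual w at p is tangent, so minimality gives \<open>f' p w = 0\<close> and hence
  \<open>w \<bullet> w = 0\<close>: at the minimizer the least-squares multiplier is the exact
  Lagrange multiplier.\<close>

lemma first_order: "f' p \<zeta> = lam p \<bullet> c' p \<zeta>"
proof -
  obtain w where w: "c' p w = 0" "\<And>\<zeta>. w \<bullet> \<zeta> = f' p \<zeta> - lam p \<bullet> c' p \<zeta>"
    using residual[OF p_ball surj_p] by blast
  have "f' p w = 0"
    by (rule lagrange_first_order[OF min contf contc f_deriv[OF p_ball] c_deriv[OF p_ball] surj_p w(1)])
  then have "w \<bullet> w = 0" using w by simp
  then show ?thesis using w(2)[of \<zeta>] by simp
qed

lemma lagrangian_gradient_bound:
  "\<exists>C>0. \<forall>\<^sub>F x in nhds p. \<forall>r. \<bar>f' x r - lam p \<bullet> c' x r\<bar> \<le> C * norm (x - p) * norm r"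
proof -
  obtain C1 where C1: "0 < C1" "\<forall>\<^sub>F x in nhds p. norm (f' x - f' p) \<le> C1 * norm (x - p)"
    using has_derivative_local_lipschitz[OF f'_deriv[OF p_ball]] by blast
  obtain C2 where C2: "0 < C2" "\<forall>\<^sub>F x in nhds p. norm (c' x - c' p) \<le> C2 * norm (x - p)"
    using has_derivative_local_lipschitz[OF c'_deriv[OF p_ball]] by blast
  have "\<forall>\<^sub>F x in nhds p. \<forall>r. \<bar>f' x r - lam p \<bullet> c' x r\<bar> \<le> (C1 + norm (lam p) * C2) * norm (x - p) * norm r"
    using C1(2) C2(2)
  proof eventually_elim
    case (elim x)
    show ?case
    proof
      fix r
      have "f' x r - lam p \<bullet> c' x r = (f' x - f' p) r - lam p \<bullet> (c' x - c' p) r"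
        using first_order[of r] by (simp add: blinfun.diff_left inner_diff_right)
      also have "\<bar>\<dots>\<bar> \<le> norm (f' x - f' p) * norm r + norm (lam p) * (norm (c' x - c' p) * norm r)"
        using norm_blinfun[of "f' x - f' p" r] norm_blinfun[of "c' x - c' p" r]
          Cauchy_Schwarz_ineq2[of "lam p" "(c' x - c' p) r"]
        by (smt (verit) mult_left_mono norm_ge_zero real_norm_def)
      also have "\<dots> \<le> C1 * norm (x - p) * norm r + norm (lam p) * (C2 * norm (x - p) * norm r)"
        using elim by (intro add_mono mult_left_mono mult_right_mono) auto
      finally show "\<bar>f' x r - lam p \<bullet> c' x r\<bar> \<le> (C1 + norm (lam p) * C2) * norm (x - p) * norm r"
        by (simp add: algebra_simps)
    qed
  qed
  then show ?thesis using C1(1) C2(1) by (intro exI[of _ "C1 + norm (lam p) * C2"]) (simp add: add_pos_nonneg)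
qed

lemma f'_tangent_bound:
  "\<exists>C>0. \<forall>\<^sub>F x in nhds p. \<forall>\<zeta>. c' x \<zeta> = 0 \<longrightarrow> \<bar>f' x \<zeta>\<bar> \<le> C * norm (x - p) * norm \<zeta>"
proof -
  obtain C where C: "0 < C" "\<forall>\<^sub>F x in nhds p. \<forall>r. \<bar>f' x r - lam p \<bullet> c' x r\<bar> \<le> C * norm (x - p) * norm r"
    using lagrangian_gradient_bound by blast
  from C(2) have "\<forall>\<^sub>F x in nhds p. \<forall>\<zeta>. c' x \<zeta> = 0 \<longrightarrow> \<bar>f' x \<zeta>\<bar> \<le> C * norm (x - p) * norm \<zeta>"
    by eventually_elim (metis diff_zero inner_zero_right)
  with C(1) show ?thesis by blast
qed

text \<open>Proved by testing instead of differentiating the formula for the multiplier: r is a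
  normal preimage of \<open>lam x - lam p\<close> under \<open>c' x\<close>, the residual at x
  vanishes on r, and what remains is the gradient of the Lagrangian frozen at p.\<close>

lemma multiplier_lipschitz: "\<exists>C>0. \<forall>\<^sub>F x in nhds p. norm (lam x - lam p) \<le> C * norm (x - p)"
proof -
  obtain R where R: "0 < R" "\<forall>\<^sub>F x in nhds p. \<forall>y. \<exists>r. c' x r = y \<and> norm r \<le> R * norm y \<and> (\<forall>\<zeta>. c' x \<zeta> = 0 \<longrightarrow> r \<bullet> \<zeta> = 0)"
    using right_inverse_bound by blast
  obtain C where C: "0 < C" "\<forall>\<^sub>F x in nhds p. \<forall>r. \<bar>f' x r - lam p \<bullet> c' x r\<bar> \<le> C * norm (x - p) * norm r"
    using lagrangian_gradient_bound by blast
  from R(2) C(2) ev_ball ev_surj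
  have "\<forall>\<^sub>F x in nhds p. norm (lam x - lam p) \<le> (C * R) * norm (x - p)"
  proof eventually_elim
    case (elim x)
    let ?y = "lam x - lam p"
    obtain r where r: "c' x r = ?y" "norm r \<le> R * norm ?y" "\<And>\<zeta>. c' x \<zeta> = 0 \<Longrightarrow> r \<bullet> \<zeta> = 0"
      using elim(1) by blast
    obtain w where w: "c' x w = 0" "\<And>\<zeta>. w \<bullet> \<zeta> = f' x \<zeta> - lam x \<bullet> c' x \<zeta>"
      using residual[OF elim(3,4)] by blast
    have "(norm ?y)\<^sup>2 = lam x \<bullet> ?y - lam p \<bullet> ?y" by (simp add: power2_norm_eq_inner inner_diff_left)
    also have "\<dots> = f' x r - lam p \<bullet> c' x r" using w(2)[of r] r(3)[OF w(1)] r(1) by (simp add: inner_commute)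
    also have "\<dots> \<le> C * norm (x - p) * norm r" using elim(2) by (meson abs_le_D1)
    also have "\<dots> \<le> C * norm (x - p) * (R * norm ?y)" using r(2) C(1) by (intro mult_left_mono) auto
    finally have "(norm ?y)\<^sup>2 \<le> (C * R * norm (x - p)) * norm ?y" by (simp add: mult_ac)
    then show ?case by (rule le_of_power2_le_mult) (use C(1) R(1) in simp)
  qed
  then show ?thesis using C(1) R(1) by (intro exI[of _ "C * R"]) simp
qed

lemma multiplier_tendsto: "(lam \<longlongrightarrow> lam p) (nhds p)"
proof -
  obtain C where C: "\<forall>\<^sub>F x in nhds p. norm (lam x - lam p) \<le> C * norm (x - p)"
    using multiplier_lipschitz by blast
  have "((\<lambda>x. C * norm (x - p)) \<longlongrightarrow> C * norm (p - p)) (nhds p)"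
    by (intro tendsto_intros filterlim_ident)
  then have "((\<lambda>x. lam x - lam p) \<longlongrightarrow> 0) (nhds p)" by (intro Lim_null_comparison[OF C]) simp
  then show ?thesis by (simp add: LIM_zero_iff)
qed

text \<open>The defect consists of the linearization remainders of \<open>f'\<close> and
  \<open>c'\<close>, quadratic by the Lipschitz bounds on the second derivatives, and of
  \<open>(lam x - lam p) \<bullet> (c' x - c' p) \<zeta>\<close>, a product of two first-order
  increments. Using the multiplier at x in place of the one at p therefore costs no order.\<close>

lemma linearized_stationarity:
  "\<exists>C>0. \<forall>\<^sub>F x in nhds p. \<forall>\<zeta>. c' x \<zeta> = 0 \<longrightarrow>
     \<bar>f' x \<zeta> - Lh x (x - p) \<bullet> \<zeta>\<bar> \<le> C * (norm (x - p))\<^sup>2 * norm \<zeta>"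
proof -
  obtain C1 where C1: "0 < C1" "\<forall>\<^sub>F x in nhds p. norm (c' x - c' p) \<le> C1 * norm (x - p)"
    using has_derivative_local_lipschitz[OF c'_deriv[OF p_ball]] by blast
  obtain C2 where C2: "0 < C2" "\<forall>\<^sub>F x in nhds p. norm (lam x - lam p) \<le> C2 * norm (x - p)"
    using multiplier_lipschitz by blast
  obtain C3 where C3: "0 < C3" "\<forall>\<^sub>F x in nhds p. norm (lam x) \<le> C3"
    using tendsto_imp_eventually_norm_bounded[OF multiplier_tendsto] by blast
  have L: "0 \<le> Lc" "0 \<le> Lf" using c''_lipschitz f''_lipschitz by (auto dest: lipschitz_on_nonneg)
  let ?K = "Lf + C3 * Lc + C2 * C1"
  from C1(2) C2(2) C3(2) ev_ball
  have "\<forall>\<^sub>F x in nhds p. \<forall>\<zeta>. c' x \<zeta> = 0 \<longrightarrow>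
     \<bar>f' x \<zeta> - Lh x (x - p) \<bullet> \<zeta>\<bar> \<le> ?K * (norm (x - p))\<^sup>2 * norm \<zeta>"
  proof eventually_elim
    case (elim x)
    have seg: "y \<in> ball p \<epsilon>" "dist y x \<le> norm (x - p)" if "y \<in> closed_segment p x" for y
    proof -
      show "y \<in> ball p \<epsilon>"
        using that elim(4) p_ball by (meson closed_segment_subset convex_ball subsetD)
      show "dist y x \<le> norm (x - p)"
        using segment_bound(2)[OF that] by (simp add: dist_norm norm_minus_commute)
    qed
    have F: "norm (f' x - f' p - f'' x (x - p)) \<le> norm (x - p) * (Lf * norm (x - p))"
    proof (rule linearization_at_endpoint[OF f'_deriv])
      fix y assume y: "y \<in> closed_segment p x"
      have "norm (f'' y - f'' x) \<le> Lf * dist y x"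
        using lipschitz_onD[OF f''_lipschitz seg(1)[OF y] elim(4)] by (simp add: dist_norm)
      also have "\<dots> \<le> Lf * norm (x - p)" by (rule mult_left_mono[OF seg(2)[OF y] L(2)])
      finally show "norm (f'' y - f'' x) \<le> Lf * norm (x - p)" .
    qed (rule seg)
    have Cc: "norm (c' x - c' p - c'' x (x - p)) \<le> norm (x - p) * (Lc * norm (x - p))"
    proof (rule linearization_at_endpoint[OF c'_deriv])
      fix y assume y: "y \<in> closed_segment p x"
      have "norm (c'' y - c'' x) \<le> Lc * dist y x"
        using lipschitz_onD[OF c''_lipschitz seg(1)[OF y] elim(4)] by (simp add: dist_norm)
      also have "\<dots> \<le> Lc * norm (x - p)" by (rule mult_left_mono[OF seg(2)[OF y] L(1)])
      finally show "norm (c'' y - c'' x) \<le> Lc * norm (x - p)" .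
    qed (rule seg)
    show ?case
    proof (intro allI impI)
      fix \<zeta> assume \<zeta>: "c' x \<zeta> = 0"
      let ?e = "norm (x - p)"
      \<comment> \<open>The terms added to complete the remainders cancel by stationarity at p and
        by \<open>c' x \<zeta> = 0\<close>.\<close>
      have "f' x \<zeta> - Lh x (x - p) \<bullet> \<zeta> = (f' x - f' p - f'' x (x - p)) \<zeta>
          - lam x \<bullet> (c' x - c' p - c'' x (x - p)) \<zeta> + (lam x - lam p) \<bullet> (c' x - c' p) \<zeta>"
        using first_order[of \<zeta>] \<zeta>
        by (simp add: Lh_inner[OF elim(4)] blinfun.diff_left inner_diff_left inner_diff_right)
      also have "\<bar>\<dots>\<bar> \<le> \<bar>(f' x - f' p - f'' x (x - p)) \<zeta>\<bar>
          + \<bar>lam x \<bullet> (c' x - c' p - c'' x (x - p)) \<zeta>\<bar> + \<bar>(lam x - lam p) \<bullet> (c' x - c' p) \<zeta>\<bar>"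
        by linarith
      also have "\<dots> \<le> (?e * (Lf * ?e)) * norm \<zeta> + C3 * ((?e * (Lc * ?e)) * norm \<zeta>) + (C2 * ?e) * ((C1 * ?e) * norm \<zeta>)"
      proof (intro add_mono)
        show "\<bar>(f' x - f' p - f'' x (x - p)) \<zeta>\<bar> \<le> (?e * (Lf * ?e)) * norm \<zeta>"
          using order_trans[OF norm_blinfun mult_right_mono[OF F norm_ge_zero]] by simp
        show "\<bar>lam x \<bullet> (c' x - c' p - c'' x (x - p)) \<zeta>\<bar> \<le> C3 * ((?e * (Lc * ?e)) * norm \<zeta>)"
          by (rule order_trans[OF Cauchy_Schwarz_ineq2])
            (intro mult_mono elim order_trans[OF norm_blinfun mult_right_mono[OF Cc norm_ge_zero]]; use C3(1) in simp)
        show "\<bar>(lam x - lam p) \<bullet> (c' x - c' p) \<zeta>\<bar> \<le> (C2 * ?e) * ((C1 * ?e) * norm \<zeta>)"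
          by (rule order_trans[OF Cauchy_Schwarz_ineq2])
            (intro mult_mono elim order_trans[OF norm_blinfun mult_right_mono[OF _ norm_ge_zero]]; use C2(1) in simp)
      qed
      also have "\<dots> = ?K * ?e\<^sup>2 * norm \<zeta>" by (simp add: algebra_simps power2_eq_square)
      finally show "\<bar>f' x \<zeta> - Lh x (x - p) \<bullet> \<zeta>\<bar> \<le> ?K * ?e\<^sup>2 * norm \<zeta>" .
    qed
  qed
  then show ?thesis using L C1(1) C2(1) C3(1) by (intro exI[of _ ?K]) (simp add: add_nonneg_pos)
qed

text \<open>Phrased for the bilinear form because \<open>lagrangian_hess\<close> is a plain function
  without an operator norm. Besides \<open>f''\<close> and \<open>c''\<close>, the multiplier varies
  with x and contributes through its own Lipschitz bound at p.\<close>

lemma Lh_bound_and_lipschitz: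
  "\<exists>C>0. \<forall>\<^sub>F x in nhds p. \<forall>t s. \<bar>Lh x t \<bullet> s\<bar> \<le> C * norm t * norm s \<and>
     \<bar>Lh x t \<bullet> s - Lh p t \<bullet> s\<bar> \<le> C * norm (x - p) * norm t * norm s"
proof -
  obtain C2 where C2: "0 < C2" "\<forall>\<^sub>F x in nhds p. norm (lam x - lam p) \<le> C2 * norm (x - p)"
    using multiplier_lipschitz by blast
  obtain C3 where C3: "0 < C3" "\<forall>\<^sub>F x in nhds p. norm (lam x) \<le> C3"
    using tendsto_imp_eventually_norm_bounded[OF multiplier_tendsto] by blast
  obtain C4 where C4: "0 < C4" "\<forall>\<^sub>F x in nhds p. norm (f'' x) \<le> C4"
    using tendsto_imp_eventually_norm_bounded[OF f''_tendsto] by blast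
  obtain C5 where C5: "0 < C5" "\<forall>\<^sub>F x in nhds p. norm (c'' x) \<le> C5"
    using tendsto_imp_eventually_norm_bounded[OF c''_tendsto] by blast
  have C5p: "norm (c'' p) \<le> C5" using eventually_nhds_x_imp_x[OF C5(2)] .
  have L: "0 \<le> Lc" "0 \<le> Lf" using c''_lipschitz f''_lipschitz by (auto dest: lipschitz_on_nonneg)
  \<comment> \<open>The sum of the constants of the two bounds, so that one constant serves
    both.\<close>
  let ?K = "(C4 + C3 * C5) + (Lf + C3 * Lc + C2 * C5)"
  have Kpos: "0 < C4 + C3 * C5" "0 \<le> Lf + C3 * Lc + C2 * C5" using L C2 C3 C4 C5 by (simp_all add: add_pos_pos)
  from C2(2) C3(2) C4(2) C5(2) ev_ball
  have "\<forall>\<^sub>F x in nhds p. \<forall>t s. \<bar>Lh x t \<bullet> s\<bar> \<le> ?K * norm t * norm s \<and>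
     \<bar>Lh x t \<bullet> s - Lh p t \<bullet> s\<bar> \<le> ?K * norm (x - p) * norm t * norm s"
  proof eventually_elim
    case (elim x)
    have Ff: "norm (f'' x - f'' p) \<le> Lf * norm (x - p)" and Fc: "norm (c'' x - c'' p) \<le> Lc * norm (x - p)"
      using lipschitz_onD[OF f''_lipschitz elim(5) p_ball] lipschitz_onD[OF c''_lipschitz elim(5) p_ball]
      by (simp_all add: dist_norm)
    have bl: "\<bar>blinfun_apply (M t) s\<bar> \<le> k * norm t * norm s" if "norm M \<le> k"
      for M :: "'a \<Rightarrow>\<^sub>L 'a \<Rightarrow>\<^sub>L real" and k t s
      using norm_blinfun2[of M t s] mult_right_mono[OF mult_right_mono[OF that norm_ge_zero[of t]] norm_ge_zero[of s]] by simp
    have bi: "\<bar>y \<bullet> blinfun_apply (M t) s\<bar> \<le> l * (k * norm t * norm s)" if "norm y \<le> l" "norm M \<le> k"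
      for y and M :: "'a \<Rightarrow>\<^sub>L 'a \<Rightarrow>\<^sub>L 'b" and k l t s
    proof -
      have "norm (M t s) \<le> k * norm t * norm s"
        using norm_blinfun2[of M t s] mult_right_mono[OF mult_right_mono[OF that(2) norm_ge_zero[of t]] norm_ge_zero[of s]] by simp
      moreover have "0 \<le> l" using that(1) norm_ge_zero order_trans by blast
      ultimately show ?thesis using that(1) by (intro order_trans[OF Cauchy_Schwarz_ineq2] mult_mono) auto
    qed
    show ?case
    proof (intro allI conjI)
      fix t s :: 'a
      let ?n = "norm t * norm s"
      have n: "0 \<le> ?n" by simp
      have "\<bar>Lh x t \<bullet> s\<bar> \<le> C4 * norm t * norm s + C3 * (C5 * norm t * norm s)"
        unfolding Lh_inner[OF elim(5)]
        by (rule order_trans[OF abs_triangle_ineq4]) (intro add_mono bl bi elim)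
      also have "\<dots> = (C4 + C3 * C5) * ?n" by (simp add: algebra_simps)
      also have "\<dots> \<le> ?K * ?n" using Kpos n by (intro mult_right_mono) auto
      finally show "\<bar>Lh x t \<bullet> s\<bar> \<le> ?K * norm t * norm s" by (simp only: mult.assoc)
      have "Lh x t \<bullet> s - Lh p t \<bullet> s = (f'' x - f'' p) t s - lam x \<bullet> (c'' x - c'' p) t s - (lam x - lam p) \<bullet> c'' p t s"
        by (simp add: Lh_inner[OF elim(5)] Lh_inner[OF p_ball] blinfun.diff_left inner_diff_left inner_diff_right)
      also have "\<bar>\<dots>\<bar> \<le> \<bar>(f'' x - f'' p) t s\<bar> + \<bar>lam x \<bullet> (c'' x - c'' p) t s\<bar> + \<bar>(lam x - lam p) \<bullet> c'' p t s\<bar>"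
        by linarith
      also have "\<dots> \<le> (Lf * norm (x - p)) * norm t * norm s + C3 * ((Lc * norm (x - p)) * norm t * norm s)
          + (C2 * norm (x - p)) * (C5 * norm t * norm s)"
        by (intro add_mono bl bi elim Ff Fc C5p)
      also have "\<dots> = (Lf + C3 * Lc + C2 * C5) * (norm (x - p) * ?n)" by (simp add: algebra_simps)
      also have "\<dots> \<le> ?K * (norm (x - p) * ?n)" using Kpos n by (intro mult_right_mono) auto
      finally show "\<bar>Lh x t \<bullet> s - Lh p t \<bullet> s\<bar> \<le> ?K * norm (x - p) * norm t * norm s" by (simp only: mult.assoc)
    qed
  qed
  then show ?thesis using Kpos by (intro exI[of _ ?K]) simp
qed

text \<open>Compactness gives coercivity of the fixed operator \<open>Lh p\<close> on the moving
  kernels; the Lipschitz bound then exchanges \<open>Lh p\<close> for \<open>Lh x\<close> at the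
  price of half the constant.\<close>

lemma Lh_coercive: "\<exists>m>0. \<forall>\<^sub>F x in nhds p. \<forall>t. c' x t = 0 \<longrightarrow> m * (norm t)\<^sup>2 \<le> Lh x t \<bullet> t"
proof -
  have lin: "linear (Lh p)"
    by (rule linearI; rule vector_eq_rdot[THEN iffD1])
      (simp_all add: Lh_inner[OF p_ball] inner_add_left blinfun.add_right blinfun.add_left blinfun.scaleR_left
        blinfun.scaleR_right inner_add_right algebra_simps)
  then have app: "blinfun_apply (Blinfun (Lh p)) = Lh p"
    by (simp add: bounded_linear_Blinfun_apply linear_conv_bounded_linear)
  have pos: "0 < Blinfun (Lh p) t \<bullet> t" if "c' p t = 0" "t \<noteq> 0" for t
  proof -
    have T: "subspace (tangent c p)" "t \<in> tangent c p" using that subspace_tangent[OF p_ball] tangent_iff[OF p_ball] by auto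
    \<comment> \<open>On tangent vectors both projectors of \<open>riem_hess_E\<close> drop out of
      the form.\<close>
    have "orth_proj (tangent c p) t = t" by (rule orth_proj_eqI[OF T]) simp
    then have "riem_hess_E f c p t \<bullet> t = Lh p t \<bullet> t"
      unfolding riem_hess_E_def comp_apply using orth_proj_in_and_normal(2)[OF T] by simp
    with hess_pos[OF T(2) that(2)] show ?thesis by (simp add: app)
  qed
  obtain m where m: "0 < m" "\<forall>\<^sub>F x in nhds p. \<forall>t. c' x t = 0 \<longrightarrow> m * (norm t)\<^sup>2 \<le> Lh p t \<bullet> t"
    using eventually_coercive_on_kernel[OF c'_tendsto tendsto_const pos] unfolding app by blast
  obtain C where C: "0 < C" "\<forall>\<^sub>F x in nhds p. \<forall>t s. \<bar>Lh x t \<bullet> s\<bar> \<le> C * norm t * norm s \<and>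
     \<bar>Lh x t \<bullet> s - Lh p t \<bullet> s\<bar> \<le> C * norm (x - p) * norm t * norm s"
    using Lh_bound_and_lipschitz by blast
  have "\<forall>\<^sub>F x in nhds p. C * norm (x - p) \<le> m / 2" using m(1) by (intro eventually_mult_norm_le) simp
  with m(2) C(2) have "\<forall>\<^sub>F x in nhds p. \<forall>t. c' x t = 0 \<longrightarrow> m / 2 * (norm t)\<^sup>2 \<le> Lh x t \<bullet> t"
  proof eventually_elim
    case (elim x)
    show ?case
    proof (intro allI impI)
      fix t assume "c' x t = 0"
      then have "m * (norm t)\<^sup>2 \<le> Lh p t \<bullet> t" using elim(1) by blast
      moreover have "\<bar>Lh x t \<bullet> t - Lh p t \<bullet> t\<bar> \<le> C * norm (x - p) * (norm t)\<^sup>2"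
        using elim(2) by (simp add: power2_eq_square mult.assoc)
      moreover have "C * norm (x - p) * (norm t)\<^sup>2 \<le> m / 2 * (norm t)\<^sup>2"
        using elim(3) by (intro mult_right_mono) auto
      ultimately show "m / 2 * (norm t)\<^sup>2 \<le> Lh x t \<bullet> t" by linarith
    qed
  qed
  then show ?thesis using m(1) by (intro exI[of _ "m / 2"]) simp
qed

section \<open>Estimates for the landing step\<close>

text \<open>Where \<open>c' x\<close> is onto, near p, the first component is the Riemannian
  gradient and the second the multiplier belonging to g. The \<open>inv\<close> of a square system
  replaces the \<open>THE\<close> over a moving subspace and can be differentiated.\<close>

definition grad_mult :: "'a \<Rightarrow> 'a \<times> 'b" where
  "grad_mult x = inv (kkt (G x) (c' x)) (\<Sum>b\<in>Basis. f' x b *\<^sub>R b, 0)"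

abbreviation v :: "'a \<Rightarrow> 'a" where "v \<equiv> riem_grad f c G"
abbreviation \<mu> :: "'a \<Rightarrow> 'b" where "\<mu> x \<equiv> snd (grad_mult x)"

lemma G_inner_pos: "u \<noteq> 0 \<Longrightarrow> 0 < G x u \<bullet> u"
  using G_pos by (simp add: gmetric_def)

lemma kkt_grad_mult:
  assumes "surj (blinfun_apply (c' x))"
  shows "kkt (G x) (c' x) (grad_mult x) = (\<Sum>b\<in>Basis. f' x b *\<^sub>R b, 0)"
  unfolding grad_mult_def
  by (rule surj_f_inv_f[OF linear_inj_imp_surj[OF linear_kkt inj_kkt[OF G_inner_pos assms]]])

lemma grad_mult_eqs:
  assumes "surj (blinfun_apply (c' x))"
  shows "c' x (fst (grad_mult x)) = 0" "G x (fst (grad_mult x)) \<bullet> \<zeta> + \<mu> x \<bullet> c' x \<zeta> = f' x \<zeta>"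
  using kkt_grad_mult[OF assms] kkt_eq_iff[OF bounded_linear.linear[OF blinfun.bounded_linear_right[of "f' x"]]]
  by blast+

lemma riem_grad_well_defined:
  assumes x: "x \<in> ball p \<epsilon>" and sj: "surj (blinfun_apply (c' x))"
  shows "\<exists>!u. u \<in> tangent c x \<and> (\<forall>\<xi>\<in>tangent c x. gmetric G x u \<xi> = Dv f x \<xi>)"
    and "v x = fst (grad_mult x)"
proof -
  let ?P = "\<lambda>u. u \<in> tangent c x \<and> (\<forall>\<xi>\<in>tangent c x. gmetric G x u \<xi> = Dv f x \<xi>)"
  have Df: "Dv f x = f' x" using frechet_derivative_at[OF f_deriv[OF x]] by simp
  have P: "?P (fst (grad_mult x))"
    using grad_mult_eqs[OF sj] by (auto simp: tangent_iff[OF x] Df gmetric_def) (metis add.right_neutral inner_zero_right)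
  have uniq: "u = fst (grad_mult x)" if "?P u" for u
  proof -
    let ?d = "u - fst (grad_mult x)"
    have "c' x ?d = 0" using that P by (simp add: tangent_iff[OF x] blinfun.diff_right)
    then have "G x u \<bullet> ?d = G x (fst (grad_mult x)) \<bullet> ?d"
      using that P by (simp add: tangent_iff[OF x] gmetric_def)
    then have "G x ?d \<bullet> ?d = 0" by (simp add: blinfun.diff_right inner_diff_left)
    then show ?thesis using G_inner_pos[of ?d x] by auto
  qed
  show "\<exists>!u. ?P u" using P uniq by blast
  show "v x = fst (grad_mult x)"
    unfolding riem_grad_def by (rule the_equality, rule P, rule uniq)
qed

lemma riem_grad_eqs:
  assumes x: "x \<in> ball p \<epsilon>" and sj: "surj (blinfun_apply (c' x))"
  shows "c' x (v x) = 0" "G x (v x) \<bullet> \<zeta> + \<mu> x \<bullet> c' x \<zeta> = f' x \<zeta>"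
  using grad_mult_eqs[OF sj] unfolding riem_grad_well_defined(2)[OF x sj] by auto

text \<open>The gradient is tested with itself: coercivity of \<open>G x\<close> bounds the form
  from below, and the tangential smallness of \<open>f' x\<close> bounds it from above.\<close>

lemma riem_grad_bound: "\<exists>C>0. \<forall>\<^sub>F x in nhds p. norm (v x) \<le> C * norm (x - p)"
proof -
  obtain m where m: "0 < m" "\<forall>\<^sub>F x in nhds p. \<forall>t. m * (norm t)\<^sup>2 \<le> G x t \<bullet> t"
    using G_coercive by blast
  obtain C where C: "0 < C" "\<forall>\<^sub>F x in nhds p. \<forall>\<zeta>. c' x \<zeta> = 0 \<longrightarrow> \<bar>f' x \<zeta>\<bar> \<le> C * norm (x - p) * norm \<zeta>"
    using f'_tangent_bound by blast
  from m(2) C(2) ev_ball ev_surj have "\<forall>\<^sub>F x in nhds p. norm (v x) \<le> C / m * norm (x - p)"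
  proof eventually_elim
    case (elim x)
    note e = riem_grad_eqs[OF elim(3,4)]
    have "m * (norm (v x))\<^sup>2 \<le> G x (v x) \<bullet> v x" using elim(1) by blast
    also have "\<dots> = f' x (v x)" using e(1) e(2)[of "v x"] by simp
    also have "\<dots> \<le> C * norm (x - p) * norm (v x)" using elim(2) e(1) by (meson abs_le_D1)
    finally have "(norm (v x))\<^sup>2 \<le> (C / m * norm (x - p)) * norm (v x)"
      using m(1) by (simp add: field_simps)
    then show ?case by (rule le_of_power2_le_mult) (use C(1) m(1) in simp)
  qed
  then show ?thesis using C(1) m(1) by (intro exI[of _ "C / m"]) simp
qed

text \<open>Both multiplier equations are tested with the same normal preimage r. Their difference
  is \<open>G x (v x) \<bullet> r\<close>, which is of first order because the gradient is.\<close>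

lemma multipliers_close: "\<exists>C>0. \<forall>\<^sub>F x in nhds p. norm (\<mu> x - lam x) \<le> C * norm (x - p)"
proof -
  obtain R where R: "0 < R" "\<forall>\<^sub>F x in nhds p. \<forall>y. \<exists>r. c' x r = y \<and> norm r \<le> R * norm y \<and> (\<forall>\<zeta>. c' x \<zeta> = 0 \<longrightarrow> r \<bullet> \<zeta> = 0)"
    using right_inverse_bound by blast
  obtain C where C: "0 < C" "\<forall>\<^sub>F x in nhds p. norm (v x) \<le> C * norm (x - p)"
    using riem_grad_bound by blast
  obtain N where N: "0 < N" "\<forall>\<^sub>F x in nhds p. norm (G x) \<le> N"
    using tendsto_imp_eventually_norm_bounded[OF G_tendsto] by blast
  from R(2) C(2) N(2) ev_ball ev_surj
  have "\<forall>\<^sub>F x in nhds p. norm (\<mu> x - lam x) \<le> (N * C * R) * norm (x - p)"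
  proof eventually_elim
    case (elim x)
    let ?y = "\<mu> x - lam x"
    obtain r where r: "c' x r = ?y" "norm r \<le> R * norm ?y" "\<And>\<zeta>. c' x \<zeta> = 0 \<Longrightarrow> r \<bullet> \<zeta> = 0"
      using elim(1) by blast
    obtain w where w: "c' x w = 0" "\<And>\<zeta>. w \<bullet> \<zeta> = f' x \<zeta> - lam x \<bullet> c' x \<zeta>"
      using residual[OF elim(4,5)] by blast
    have "(norm ?y)\<^sup>2 = \<mu> x \<bullet> c' x r - lam x \<bullet> c' x r"
      unfolding r(1) by (simp add: power2_norm_eq_inner inner_diff_left)
    also have "\<dots> = - (G x (v x) \<bullet> r)"
      using w(2)[of r] r(3)[OF w(1)] riem_grad_eqs(2)[OF elim(4,5), of r] by (simp add: inner_commute)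
    also have "\<dots> \<le> norm (G x (v x)) * norm r" using Cauchy_Schwarz_ineq2[of "G x (v x)" r] by linarith
    also have "\<dots> \<le> (N * (C * norm (x - p))) * (R * norm ?y)"
      by (intro mult_mono r(2) order_trans[OF norm_blinfun] elim) (use N(1) C(1) in auto)
    finally have "(norm ?y)\<^sup>2 \<le> (N * C * R * norm (x - p)) * norm ?y" by (simp only: mult_ac)
    then show ?case by (rule le_of_power2_le_mult) (use C(1) R(1) N(1) in simp)
  qed
  then show ?thesis using C(1) R(1) N(1) by (intro exI[of _ "N * C * R"]) simp
qed

lemma has_derivative_blinfun_applied:
  "(h has_derivative h') F \<Longrightarrow> ((\<lambda>y. blinfun_apply (h y) b) has_derivative (\<lambda>\<xi>. blinfun_apply (h' \<xi>) b)) F"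
  by (rule bounded_linear.has_derivative[OF blinfun.bounded_linear_left])

lemma grad_mult_differentiable:
  assumes x: "x \<in> ball p \<epsilon>" and sj: "\<forall>\<^sub>F y in nhds x. surj (blinfun_apply (c' y))"
  shows "grad_mult differentiable (at x)"
proof (rule differentiable_componentwise_linear_solution)
  show "linear (kkt (G y) (c' y))" for y by (rule linear_kkt)
  show "(\<lambda>y. kkt (G y) (c' y) u) differentiable (at x)" for u
    unfolding kkt_def
    by (rule differentiableI)
      (auto intro!: derivative_eq_intros has_derivative_blinfun_applied G_deriv c'_deriv[OF x])
  show "(\<lambda>y. (\<Sum>b\<in>Basis. f' y b *\<^sub>R b, 0)) differentiable (at x)"
    by (rule differentiableI) (auto intro!: derivative_eq_intros has_derivative_blinfun_applied f'_deriv[OF x])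
  show "inj (kkt (G x) (c' x))"
    by (rule inj_kkt[OF G_inner_pos eventually_nhds_x_imp_x[OF sj]])
  show "\<forall>\<^sub>F y in nhds x. kkt (G y) (c' y) (grad_mult y) = (\<Sum>b\<in>Basis. f' y b *\<^sub>R b, 0)"
    using sj by eventually_elim (rule kkt_grad_mult)
qed

text \<open>Both equations of the system are differentiated at x. The test vector \<zeta> stays
  fixed and has to be tangent at x only, so the derivative of \<mu> enters solely through its
  product with \<open>c' x \<zeta> = 0\<close> and disappears.\<close>

lemma riem_grad_derivative:
  assumes x: "x \<in> ball p \<epsilon>" and sj: "\<forall>\<^sub>F y in nhds x. surj (blinfun_apply (c' y))"
  shows "v differentiable (at x)"
    and "c' x (Dv v x \<xi>) + c'' x \<xi> (v x) = 0"
    and "c' x \<zeta> = 0 \<Longrightarrow>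
      G x (Dv v x \<xi>) \<bullet> \<zeta> + G' x \<xi> (v x) \<bullet> \<zeta> + \<mu> x \<bullet> c'' x \<xi> \<zeta> = f'' x \<xi> \<zeta>"
proof -
  obtain z' where z': "(grad_mult has_derivative z') (at x)"
    using grad_mult_differentiable[OF x sj] by (auto simp: differentiable_def)
  have evb: "\<forall>\<^sub>F y in nhds x. y \<in> ball p \<epsilon>" using x by (intro eventually_nhds_in_open) auto
  have ev: "\<forall>\<^sub>F y in nhds x. fst (grad_mult y) = v y"
    using sj evb by eventually_elim (simp add: riem_grad_well_defined(2))
  have "((\<lambda>y. fst (grad_mult y)) has_derivative (\<lambda>h. fst (z' h))) (at x)"
    by (intro has_derivative_fst z')
  then have v': "(v has_derivative (\<lambda>h. fst (z' h))) (at x)"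
    by (rule has_derivative_transform_eventually)
      (use ev eventually_nhds_x_imp_x[OF ev] in \<open>auto simp: eventually_at_filter elim: eventually_mono\<close>)
  have mu': "(\<mu> has_derivative (\<lambda>h. snd (z' h))) (at x)" by (intro has_derivative_snd z')
  have D: "Dv v x = (\<lambda>h. fst (z' h))" using frechet_derivative_at[OF v'] by simp
  show "v differentiable (at x)" using v' by (rule differentiableI)
  have zero: "h' \<xi> = 0" if "(h has_derivative h') (at x)" "\<forall>\<^sub>F y in nhds x. h y = 0"
    for h :: "'a \<Rightarrow> 'c::real_normed_vector" and h'
  proof -
    have "(h has_derivative (\<lambda>_. 0)) (at x)"
      by (rule has_derivative_transform_eventually[OF has_derivative_const[of 0]])
        (use that(2) eventually_nhds_x_imp_x[OF that(2)] in \<open>auto simp: eventually_at_filter elim: eventually_mono\<close>)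
    then show ?thesis using has_derivative_unique[OF that(1)] by metis
  qed
  have "((\<lambda>y. c' y (v y)) has_derivative (\<lambda>h. c' x (fst (z' h)) + c'' x h (v x))) (at x)"
    by (rule bounded_bilinear.FDERIV[OF bounded_bilinear_blinfun_apply c'_deriv[OF x] v'])
  moreover have "\<forall>\<^sub>F y in nhds x. c' y (v y) = 0"
    using sj evb by eventually_elim (rule riem_grad_eqs(1))
  ultimately show "c' x (Dv v x \<xi>) + c'' x \<xi> (v x) = 0"
    unfolding D by (rule zero)
  assume \<zeta>: "c' x \<zeta> = 0"
  have "((\<lambda>y. G y (v y) \<bullet> \<zeta> + \<mu> y \<bullet> c' y \<zeta> - f' y \<zeta>) has_derivative
      (\<lambda>h. (G x (fst (z' h)) + G' x h (v x)) \<bullet> \<zeta> + (\<mu> x \<bullet> c'' x h \<zeta> + snd (z' h) \<bullet> c' x \<zeta>) - f'' x h \<zeta>)) (at x)"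
    by (intro has_derivative_diff has_derivative_add has_derivative_inner_left has_derivative_inner mu'
        bounded_bilinear.FDERIV[OF bounded_bilinear_blinfun_apply G_deriv v']
        has_derivative_blinfun_applied c'_deriv[OF x] f'_deriv[OF x])
  moreover have "\<forall>\<^sub>F y in nhds x. G y (v y) \<bullet> \<zeta> + \<mu> y \<bullet> c' y \<zeta> - f' y \<zeta> = 0"
    using sj evb by eventually_elim (simp add: riem_grad_eqs(2))
  ultimately have "(G x (Dv v x \<xi>) + G' x \<xi> (v x)) \<bullet> \<zeta>
      + (\<mu> x \<bullet> c'' x \<xi> \<zeta> + snd (z' \<xi>) \<bullet> c' x \<zeta>) - f'' x \<xi> \<zeta> = 0"
    unfolding D by (rule zero)
  then show "G x (Dv v x \<xi>) \<bullet> \<zeta> + G' x \<xi> (v x) \<bullet> \<zeta> + \<mu> x \<bullet> c'' x \<xi> \<zeta> = f'' x \<xi> \<zeta>"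
    using \<zeta> by (simp add: inner_add_left)
qed

section \<open>Riemannian Hessian near the minimizer\<close>

lemma riem_hess_linear_into_tangent:
  assumes x: "x \<in> ball p \<epsilon>" and sj: "\<forall>\<^sub>F y in nhds x. surj (blinfun_apply (c' y))"
  shows "linear (riem_hess f c G A x)" "riem_hess f c G A x ` tangent c x \<subseteq> tangent c x"
proof -
  have T: "subspace (tangent c x)" using x by (rule subspace_tangent)
  have D: "linear (Dv v x)" by (rule linear_frechet_derivative[OF riem_grad_derivative(1)[OF x sj]])
  have "linear (\<lambda>\<xi>. orth_proj (tangent c x) (Dv v x \<xi>))"
    using linear_compose[OF D linear_orth_proj[OF T]] by (simp add: o_def)
  moreover have "linear (\<lambda>\<xi>. A x \<xi> (v x))"
    by (rule bounded_linear.linear) (auto intro!: bounded_linear_intros)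
  ultimately show "linear (riem_hess f c G A x)"
    unfolding riem_hess_def[abs_def] connection_def by (rule linear_compose_add)
  have sjx: "surj (blinfun_apply (c' x))" using eventually_nhds_x_imp_x[OF sj] .
  have "x \<in> regular_points c" "v x \<in> tangent c x"
    using regular_iff[OF x] sjx riem_grad_eqs(1)[OF x sjx] tangent_iff[OF x] by auto
  then have "A x \<xi> (v x) \<in> tangent c x" if "\<xi> \<in> tangent c x" for \<xi>
    using conn that unfolding connection_field_def by blast
  then show "riem_hess f c G A x ` tangent c x \<subseteq> tangent c x"
    unfolding riem_hess_def connection_def
    by (auto intro!: subspace_add[OF T] orth_proj_in_and_normal(1)[OF T])
qed

text \<open>Differentiating the gradient at an iterate requires full rank on a neighbourhood of that
  iterate.\<close>

lemma ev_ev_surj: "\<forall>\<^sub>F x in nhds p. \<forall>\<^sub>F y in nhds x. surj (blinfun_apply (c' y))"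
  using ev_surj by (simp add: eventually_eventually)

text \<open>Since the gradient vanishes to first order at \<open>p\<close>, the terms of the Hessian that depend on
  the connection and on the derivative of the metric are of order \<open>norm (x - p)\<close>.\<close>

lemma riem_hess_close:
  "\<exists>C>0. \<forall>\<^sub>F x in nhds p. \<forall>\<xi> \<zeta>. c' x \<zeta> = 0 \<longrightarrow>
     \<bar>G x (riem_hess f c G A x \<xi>) \<bullet> \<zeta> - Lh x \<xi> \<bullet> \<zeta>\<bar> \<le> C * norm (x - p) * norm \<xi> * norm \<zeta>"
proof -
  obtain R where R: "0 < R" "\<forall>\<^sub>F x in nhds p. \<forall>y. \<exists>r. c' x r = y \<and> norm r \<le> R * norm y \<and> (\<forall>\<zeta>. c' x \<zeta> = 0 \<longrightarrow> r \<bullet> \<zeta> = 0)"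
    using right_inverse_bound by blast
  obtain V where V: "0 < V" "\<forall>\<^sub>F x in nhds p. norm (v x) \<le> V * norm (x - p)"
    using riem_grad_bound by blast
  obtain M where M: "0 < M" "\<forall>\<^sub>F x in nhds p. norm (\<mu> x - lam x) \<le> M * norm (x - p)"
    using multipliers_close by blast
  obtain N where N: "0 < N" "\<forall>\<^sub>F x in nhds p. norm (G x) \<le> N"
    using tendsto_imp_eventually_norm_bounded[OF G_tendsto] by blast
  obtain N' where N': "0 < N'" "\<forall>\<^sub>F x in nhds p. norm (G' x) \<le> N'"
    using tendsto_imp_eventually_norm_bounded[OF G'_tendsto] by blast
  obtain K where K: "0 < K" "\<forall>\<^sub>F x in nhds p. norm (c'' x) \<le> K"
    using tendsto_imp_eventually_norm_bounded[OF c''_tendsto] by blast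
  obtain a where a: "0 < a" "\<forall>\<^sub>F x in nhds p. norm (A x) \<le> a"
    using A_bound by blast
  let ?C = "N * (R * (K * V)) + N * (a * V) + N' * V + M * K"
  have "\<forall>\<^sub>F x in nhds p. \<forall>\<xi> \<zeta>. c' x \<zeta> = 0 \<longrightarrow>
     \<bar>G x (riem_hess f c G A x \<xi>) \<bullet> \<zeta> - Lh x \<xi> \<bullet> \<zeta>\<bar> \<le> ?C * norm (x - p) * norm \<xi> * norm \<zeta>"
    using R(2) V(2) M(2) N(2) N'(2) K(2) a(2) ev_ball ev_ev_surj
  proof eventually_elim
    case (elim x)
    let ?e = "norm (x - p)"
    note d = riem_grad_derivative[OF elim(8,9)]
    note T = subspace_tangent[OF elim(8)]
    show ?case
    proof (intro allI impI)
      fix \<xi> \<zeta> :: 'a assume \<zeta>: "c' x \<zeta> = 0"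
      \<comment> \<open>The derivative of the gradient need not be tangent. Its normal part is r,
        which is what the projection in the connection removes; it is small because
        \<open>c' x (Dv v x \<xi>)\<close> equals \<open>- c'' x \<xi> (v x)\<close>.\<close>
      obtain r where r: "c' x r = c' x (Dv v x \<xi>)" "norm r \<le> R * norm (c' x (Dv v x \<xi>))"
          "\<And>\<zeta>. c' x \<zeta> = 0 \<Longrightarrow> r \<bullet> \<zeta> = 0"
        using elim(1) by blast
      have bv: "norm (blinfun_apply (blinfun_apply B \<xi>) (v x)) \<le> k * V * ?e * norm \<xi>"
        if "norm B \<le> k" for B :: "'a \<Rightarrow>\<^sub>L 'a \<Rightarrow>\<^sub>L 'c::real_normed_vector" and k
      proof -
        have "0 \<le> k" using that norm_ge_zero order_trans by blast
        then have "norm B * norm \<xi> * norm (v x) \<le> k * norm \<xi> * (V * ?e)"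
          using that elim(2) by (intro mult_mono) auto
        then show ?thesis using norm_blinfun2[of B \<xi> "v x"] by (simp add: mult_ac)
      qed
      have "c' x (Dv v x \<xi>) = - c'' x \<xi> (v x)" using d(2)[of \<xi>] by (simp add: eq_neg_iff_add_eq_0)
      then have "norm (c' x (Dv v x \<xi>)) \<le> K * V * ?e * norm \<xi>" using bv[OF elim(6)] by simp
      with r(2) R(1) have nr: "norm r \<le> R * (K * V * ?e * norm \<xi>)"
        by (meson less_imp_le mult_left_mono order_trans)
      have "orth_proj (tangent c x) (Dv v x \<xi>) = Dv v x \<xi> - r"
        by (rule orth_proj_eqI[OF T]) (use r in \<open>simp_all add: tangent_iff[OF elim(8)] blinfun.diff_right\<close>)
      then have H: "riem_hess f c G A x \<xi> = Dv v x \<xi> - r + A x \<xi> (v x)"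
        unfolding riem_hess_def connection_def by simp
      have "G x (riem_hess f c G A x \<xi>) \<bullet> \<zeta> - Lh x \<xi> \<bullet> \<zeta>
          = - (G x r \<bullet> \<zeta>) + G x (A x \<xi> (v x)) \<bullet> \<zeta> - G' x \<xi> (v x) \<bullet> \<zeta> - (\<mu> x - lam x) \<bullet> c'' x \<xi> \<zeta>"
        unfolding H using d(3)[OF \<zeta>, of \<xi>]
        by (simp add: Lh_inner[OF elim(8)] blinfun.diff_right blinfun.add_right inner_diff_left inner_add_left)
      also have "\<bar>\<dots>\<bar> \<le> \<bar>G x r \<bullet> \<zeta>\<bar> + \<bar>G x (A x \<xi> (v x)) \<bullet> \<zeta>\<bar> + \<bar>G' x \<xi> (v x) \<bullet> \<zeta>\<bar> + \<bar>(\<mu> x - lam x) \<bullet> c'' x \<xi> \<zeta>\<bar>"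
        by linarith
      also have "\<dots> \<le> (N * (R * (K * V * ?e * norm \<xi>))) * norm \<zeta> + (N * (a * V * ?e * norm \<xi>)) * norm \<zeta>
          + (N' * V * ?e * norm \<xi>) * norm \<zeta> + (M * ?e) * (K * norm \<xi> * norm \<zeta>)"
      proof (intro add_mono)
        have GG: "\<bar>G x u \<bullet> \<zeta>\<bar> \<le> (N * k) * norm \<zeta>" if "norm u \<le> k" for u k
          by (intro order_trans[OF Cauchy_Schwarz_ineq2] mult_right_mono order_trans[OF norm_blinfun] mult_mono elim that)
            (use N(1) in auto)
        show "\<bar>G x r \<bullet> \<zeta>\<bar> \<le> (N * (R * (K * V * ?e * norm \<xi>))) * norm \<zeta>" by (rule GG[OF nr])
        show "\<bar>G x (A x \<xi> (v x)) \<bullet> \<zeta>\<bar> \<le> (N * (a * V * ?e * norm \<xi>)) * norm \<zeta>" by (rule GG[OF bv[OF elim(7)]])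
        show "\<bar>G' x \<xi> (v x) \<bullet> \<zeta>\<bar> \<le> (N' * V * ?e * norm \<xi>) * norm \<zeta>"
          by (intro order_trans[OF Cauchy_Schwarz_ineq2] mult_right_mono bv[OF elim(5)]) simp
        show "\<bar>(\<mu> x - lam x) \<bullet> c'' x \<xi> \<zeta>\<bar> \<le> (M * ?e) * (K * norm \<xi> * norm \<zeta>)"
          by (intro order_trans[OF Cauchy_Schwarz_ineq2] mult_mono order_trans[OF norm_blinfun2] elim)
            (use M(1) K(1) in auto)
      qed
      also have "\<dots> = ?C * ?e * norm \<xi> * norm \<zeta>" by (simp add: algebra_simps)
      finally show "\<bar>G x (riem_hess f c G A x \<xi>) \<bullet> \<zeta> - Lh x \<xi> \<bullet> \<zeta>\<bar> \<le> ?C * ?e * norm \<xi> * norm \<zeta>" .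
    qed
  qed
  then show ?thesis using R(1) V(1) M(1) N(1) N'(1) K(1) a(1)
    by (intro exI[of _ ?C]) (simp add: add_pos_pos)
qed

text \<open>In the metric g the Hessian inherits the coercivity of \<open>Lh x\<close> up to half
  the constant. This yields both its injectivity on the tangent space and the size of the Newton
  step.\<close>

lemma riem_hess_coercive:
  "\<exists>m>0. \<forall>\<^sub>F x in nhds p. \<forall>t. c' x t = 0 \<longrightarrow> m * (norm t)\<^sup>2 \<le> G x (riem_hess f c G A x t) \<bullet> t"
proof -
  obtain m where m: "0 < m" "\<forall>\<^sub>F x in nhds p. \<forall>t. c' x t = 0 \<longrightarrow> m * (norm t)\<^sup>2 \<le> Lh x t \<bullet> t"
    using Lh_coercive by blast
  obtain C where C: "0 < C" "\<forall>\<^sub>F x in nhds p. \<forall>\<xi> \<zeta>. c' x \<zeta> = 0 \<longrightarrow>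
     \<bar>G x (riem_hess f c G A x \<xi>) \<bullet> \<zeta> - Lh x \<xi> \<bullet> \<zeta>\<bar> \<le> C * norm (x - p) * norm \<xi> * norm \<zeta>"
    using riem_hess_close by blast
  have "\<forall>\<^sub>F x in nhds p. C * norm (x - p) \<le> m / 2" using m(1) by (intro eventually_mult_norm_le) simp
  with m(2) C(2) have "\<forall>\<^sub>F x in nhds p. \<forall>t. c' x t = 0 \<longrightarrow>
      m / 2 * (norm t)\<^sup>2 \<le> G x (riem_hess f c G A x t) \<bullet> t"
  proof eventually_elim
    case (elim x)
    show ?case
    proof (intro allI impI)
      fix t assume t: "c' x t = 0"
      have "m * (norm t)\<^sup>2 \<le> Lh x t \<bullet> t" using elim(1) t by blast
      moreover have "\<bar>G x (riem_hess f c G A x t) \<bullet> t - Lh x t \<bullet> t\<bar> \<le> C * norm (x - p) * (norm t)\<^sup>2"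
        using elim(2) t by (simp add: power2_eq_square mult.assoc)
      moreover have "C * norm (x - p) * (norm t)\<^sup>2 \<le> m / 2 * (norm t)\<^sup>2"
        using elim(3) by (intro mult_right_mono) auto
      ultimately show "m / 2 * (norm t)\<^sup>2 \<le> G x (riem_hess f c G A x t) \<bullet> t" by linarith
    qed
  qed
  then show ?thesis using m(1) by (intro exI[of _ "m / 2"]) simp
qed

lemma riem_hess_bij: "\<forall>\<^sub>F x in nhds p. bij_betw (riem_hess f c G A x) (tangent c x) (tangent c x)"
proof -
  obtain m where m: "0 < m" "\<forall>\<^sub>F x in nhds p. \<forall>t. c' x t = 0 \<longrightarrow> m * (norm t)\<^sup>2 \<le> G x (riem_hess f c G A x t) \<bullet> t"
    using riem_hess_coercive by blast
  from m(2) ev_ball ev_ev_surj show ?thesis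
  proof eventually_elim
    case (elim x)
    show ?case
    proof (rule bij_betw_linear_subspace[OF _ subspace_tangent[OF elim(2)]])
      show "linear (riem_hess f c G A x)" "riem_hess f c G A x ` tangent c x \<subseteq> tangent c x"
        using riem_hess_linear_into_tangent[OF elim(2,3)] by auto
      fix t assume "t \<in> tangent c x" "riem_hess f c G A x t = 0"
      then have "m * (norm t)\<^sup>2 \<le> 0"
        using elim(1)[rule_format, of t] by (simp add: tangent_iff[OF elim(2)] blinfun.zero_right)
      then show "t = 0" using m(1) by (simp add: mult_le_0_iff)
    qed
  qed
qed

section \<open>Tangential and normal steps\<close>

text \<open>The two Hessians differ by a first-order factor times \<open>norm s\<close>, and s is
  itself of first order, so replacing one by the other leaves a second-order defect.\<close>

lemma newton_direction:
  "\<exists>C>0. \<forall>\<^sub>F x in nhds p. let s = inv_into (tangent c x) (riem_hess f c G A x) (v x) in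
     c' x s = 0 \<and> (\<forall>\<zeta>. c' x \<zeta> = 0 \<longrightarrow> \<bar>Lh x s \<bullet> \<zeta> - f' x \<zeta>\<bar> \<le> C * (norm (x - p))\<^sup>2 * norm \<zeta>)"
proof -
  obtain m where m: "0 < m" "\<forall>\<^sub>F x in nhds p. \<forall>t. c' x t = 0 \<longrightarrow> m * (norm t)\<^sup>2 \<le> G x (riem_hess f c G A x t) \<bullet> t"
    using riem_hess_coercive by blast
  obtain C where C: "0 < C" "\<forall>\<^sub>F x in nhds p. \<forall>\<xi> \<zeta>. c' x \<zeta> = 0 \<longrightarrow>
     \<bar>G x (riem_hess f c G A x \<xi>) \<bullet> \<zeta> - Lh x \<xi> \<bullet> \<zeta>\<bar> \<le> C * norm (x - p) * norm \<xi> * norm \<zeta>"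
    using riem_hess_close by blast
  obtain D where D: "0 < D" "\<forall>\<^sub>F x in nhds p. \<forall>\<zeta>. c' x \<zeta> = 0 \<longrightarrow> \<bar>f' x \<zeta>\<bar> \<le> D * norm (x - p) * norm \<zeta>"
    using f'_tangent_bound by blast
  from m(2) C(2) D(2) riem_hess_bij ev_ball ev_surj
  have "\<forall>\<^sub>F x in nhds p. let s = inv_into (tangent c x) (riem_hess f c G A x) (v x) in
     c' x s = 0 \<and> (\<forall>\<zeta>. c' x \<zeta> = 0 \<longrightarrow> \<bar>Lh x s \<bullet> \<zeta> - f' x \<zeta>\<bar> \<le> (C * (D / m)) * (norm (x - p))\<^sup>2 * norm \<zeta>)"
  proof eventually_elim
    case (elim x)
    let ?H = "riem_hess f c G A x"
    define s where "s = inv_into (tangent c x) ?H (v x)"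
    note e = riem_grad_eqs[OF elim(5,6)]
    have "v x \<in> ?H ` tangent c x" using elim(4) e(1) tangent_iff[OF elim(5)] by (simp add: bij_betw_def)
    then have "s \<in> tangent c x" and Hs: "?H s = v x"
      unfolding s_def by (auto intro: inv_into_into f_inv_into_f)
    then have s: "c' x s = 0" by (simp add: tangent_iff[OF elim(5)])
    have Gv: "G x (v x) \<bullet> \<zeta> = f' x \<zeta>" if "c' x \<zeta> = 0" for \<zeta> using e(2)[of \<zeta>] that by simp
    \<comment> \<open>The Newton equation is tested with s itself, which gives
      \<open>norm s = O(norm (x - p))\<close>.\<close>
    have "m * (norm s)\<^sup>2 \<le> f' x s" using elim(1)[rule_format, OF s] by (simp add: Hs Gv[OF s])
    also have "\<dots> \<le> D * norm (x - p) * norm s" using elim(3) s by (meson abs_le_D1)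
    finally have "(norm s)\<^sup>2 \<le> (D / m * norm (x - p)) * norm s" using m(1) by (simp add: field_simps)
    then have ns: "norm s \<le> D / m * norm (x - p)"
      by (rule le_of_power2_le_mult) (use D(1) m(1) in simp)
    have "\<bar>Lh x s \<bullet> \<zeta> - f' x \<zeta>\<bar> \<le> (C * (D / m)) * (norm (x - p))\<^sup>2 * norm \<zeta>" if \<zeta>: "c' x \<zeta> = 0" for \<zeta>
    proof -
      have "\<bar>Lh x s \<bullet> \<zeta> - f' x \<zeta>\<bar> \<le> C * norm (x - p) * norm s * norm \<zeta>"
        using elim(2)[rule_format, OF \<zeta>, of s] unfolding Hs Gv[OF \<zeta>] by (simp add: abs_minus_commute)
      also have "\<dots> \<le> C * norm (x - p) * (D / m * norm (x - p)) * norm \<zeta>"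
        using ns C(1) by (intro mult_right_mono mult_left_mono) auto
      finally show ?thesis by (simp add: power2_eq_square mult_ac)
    qed
    with s show ?case by (simp add: s_def)
  qed
  then show ?thesis using C(1) D(1) m(1) by (intro exI[of _ "C * (D / m)"]) simp
qed

text \<open>The normal step is \<open>G\<close>-orthogonal to the tangent space; the hypothesis on the normal space and
  the symmetry of the Hessian make it orthogonal to the tangent space for the Lagrangian Hessian.\<close>

lemma normal_direction:
  "\<forall>\<^sub>F x in nhds p. \<forall>y. c' x (pinv_g c G x y) = y \<and> (\<forall>\<zeta>. c' x \<zeta> = 0 \<longrightarrow> Lh x (pinv_g c G x y) \<bullet> \<zeta> = 0)"
  using normal ev_ball ev_surj
proof eventually_elim
  case (elim x)
  note n = bij_and_pinv_g[where G=G, OF c_deriv[OF elim(2)] elim(3) G_inner_pos]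
  have "Lh x (pinv_g c G x y) \<bullet> \<zeta> = 0" if \<zeta>: "c' x \<zeta> = 0" for y \<zeta>
  proof -
    have "pinv_g c G x y \<in> g_normal_space c G x"
      unfolding g_normal_space_def gmetric_def using n(3) by (simp add: tangent_iff[OF elim(2)])
    then have "Lh x \<zeta> \<bullet> pinv_g c G x y = 0"
      unfolding elim(1) using \<zeta> by (simp add: orthogonal_comp_def orthogonal_def tangent_iff[OF elim(2)])
    then show ?thesis using Lh_symmetric[OF elim(2)] by metis
  qed
  with n(2) show ?case by blast
qed

lemma constraint_linearization:
  "\<exists>C>0. \<forall>\<^sub>F x in nhds p. norm (c' x (x - p) - c x) \<le> C * (norm (x - p))\<^sup>2"
proof -
  obtain C where C: "0 < C" "\<forall>\<^sub>F x in nhds p. norm (c' x - c' p) \<le> C * norm (x - p)"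
    using has_derivative_local_lipschitz[OF c'_deriv[OF p_ball]] by blast
  obtain d where d: "0 < d" "\<And>y. dist y p < d \<Longrightarrow> norm (c' y - c' p) \<le> C * norm (y - p)"
    using C(2) by (auto simp: eventually_nhds_metric)
  have cp: "c p = 0" using min by (simp add: constrained_local_min_def)
  have "\<forall>\<^sub>F x in nhds p. dist x p < d" using d(1) by (auto simp: eventually_nhds_metric)
  with ev_ball have "\<forall>\<^sub>F x in nhds p. norm (c' x (x - p) - c x) \<le> (2 * C) * (norm (x - p))\<^sup>2"
  proof eventually_elim
    case (elim x)
    have "norm (c x - c p - c' x (x - p)) \<le> norm (x - p) * (2 * C * norm (x - p))"
    proof (rule linearization_at_endpoint)
      fix y assume y: "y \<in> closed_segment p x"
      show "(c has_derivative c' y) (at y)"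
        using y elim(1) p_ball by (intro c_deriv) (meson closed_segment_subset convex_ball subsetD)
      have yp: "norm (y - p) \<le> norm (x - p)" using segment_bound(1)[OF y] by simp
      \<comment> \<open>The increment bound for \<open>c'\<close> is anchored at p, so y and x are
        compared through p; this doubles the constant.\<close>
      have "norm (c' y - c' x) \<le> norm (c' y - c' p) + norm (c' x - c' p)"
        using norm_triangle_ineq4[of "c' y - c' p" "c' x - c' p"] by simp
      also have "\<dots> \<le> C * norm (y - p) + C * norm (x - p)"
        using elim(2) yp by (intro add_mono d(2)) (auto simp: dist_norm)
      also have "\<dots> \<le> C * norm (x - p) + C * norm (x - p)"
        using yp C(1) by (intro add_mono mult_left_mono) auto
      finally show "norm (c' y - c' x) \<le> 2 * C * norm (x - p)" by simp
    qed
    then show ?case by (simp add: cp norm_minus_commute power2_eq_square mult_ac)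
  qed
  then show ?thesis using C(1) by (intro exI[of _ "2 * C"]) simp
qed

text \<open>The error after the step solves the linearized optimality system up to \<open>(norm (x - p))\<^sup>2\<close>: its
  normal part is controlled by the constraint, its tangential part by coercivity.\<close>

lemma landing_step_error:
  "\<exists>\<gamma>>0. \<forall>\<^sub>F x in nhds p. norm (landing_step f c G A x - p) \<le> \<gamma> * (norm (x - p))\<^sup>2"
proof -
  obtain R where R: "0 < R" "\<forall>\<^sub>F x in nhds p. \<forall>y. \<exists>r. c' x r = y \<and> norm r \<le> R * norm y \<and> (\<forall>\<zeta>. c' x \<zeta> = 0 \<longrightarrow> r \<bullet> \<zeta> = 0)"
    using right_inverse_bound by blast
  obtain m where m: "0 < m" "\<forall>\<^sub>F x in nhds p. \<forall>t. c' x t = 0 \<longrightarrow> m * (norm t)\<^sup>2 \<le> Lh x t \<bullet> t"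
    using Lh_coercive by blast
  obtain K where K: "0 < K" "\<forall>\<^sub>F x in nhds p. \<forall>t s. \<bar>Lh x t \<bullet> s\<bar> \<le> K * norm t * norm s \<and>
     \<bar>Lh x t \<bullet> s - Lh p t \<bullet> s\<bar> \<le> K * norm (x - p) * norm t * norm s"
    using Lh_bound_and_lipschitz by blast
  obtain C1 where C1: "0 < C1" "\<forall>\<^sub>F x in nhds p. \<forall>\<zeta>. c' x \<zeta> = 0 \<longrightarrow>
     \<bar>f' x \<zeta> - Lh x (x - p) \<bullet> \<zeta>\<bar> \<le> C1 * (norm (x - p))\<^sup>2 * norm \<zeta>"
    using linearized_stationarity by blast
  obtain C2 where C2: "0 < C2" "\<forall>\<^sub>F x in nhds p. let s = inv_into (tangent c x) (riem_hess f c G A x) (v x) in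
     c' x s = 0 \<and> (\<forall>\<zeta>. c' x \<zeta> = 0 \<longrightarrow> \<bar>Lh x s \<bullet> \<zeta> - f' x \<zeta>\<bar> \<le> C2 * (norm (x - p))\<^sup>2 * norm \<zeta>)"
    using newton_direction by blast
  obtain C3 where C3: "0 < C3" "\<forall>\<^sub>F x in nhds p. norm (c' x (x - p) - c x) \<le> C3 * (norm (x - p))\<^sup>2"
    using constraint_linearization by blast
  let ?Q = "(C1 + C2 + K * (R * C3)) / m"
  from R(2) m(2) K(2) C1(2) C2(2) C3(2) normal_direction ev_ball
  have "\<forall>\<^sub>F x in nhds p. norm (landing_step f c G A x - p) \<le> (?Q + R * C3) * (norm (x - p))\<^sup>2"
  proof eventually_elim
    case (elim x)
    let ?E = "(norm (x - p))\<^sup>2"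
    define s where "s = inv_into (tangent c x) (riem_hess f c G A x) (v x)"
    define n where "n = pinv_g c G x (c x)"
    define d where "d = x - p - s - n"
    have step: "landing_step f c G A x - p = d"
      unfolding landing_step_def d_def s_def n_def by simp
    have s: "c' x s = 0" "\<And>\<zeta>. c' x \<zeta> = 0 \<Longrightarrow> \<bar>Lh x s \<bullet> \<zeta> - f' x \<zeta>\<bar> \<le> C2 * ?E * norm \<zeta>"
      using elim(5) unfolding s_def Let_def by blast+
    have n: "c' x n = c x" "\<And>\<zeta>. c' x \<zeta> = 0 \<Longrightarrow> Lh x n \<bullet> \<zeta> = 0"
      using elim(7) unfolding n_def by blast+
    have Ldiff: "Lh x (a - b) \<bullet> \<zeta> = Lh x a \<bullet> \<zeta> - Lh x b \<bullet> \<zeta>" for a b \<zeta>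
      by (simp add: Lh_inner[OF elim(8)] blinfun.diff_right blinfun.diff_left inner_diff_right)
    \<comment> \<open>The tangential step is invisible to \<open>c' x\<close>, and the normal step
      reproduces \<open>c x\<close>.\<close>
    have "c' x d = c' x (x - p) - c x"
      unfolding d_def using s(1) n(1) by (simp add: blinfun.diff_right)
    with elim(6) have Jd: "norm (c' x d) \<le> C3 * ?E" by simp
    \<comment> \<open>A vector of second order with the same image as d; subtracting it leaves a
      tangent vector t, on which \<open>Lh x\<close> is coercive.\<close>
    obtain r where r: "c' x r = c' x d" "norm r \<le> R * norm (c' x d)" using elim(1) by blast
    have nr: "norm r \<le> R * (C3 * ?E)" using r(2) Jd R(1) by (meson less_imp_le mult_left_mono order_trans)
    define t where "t = d - r"
    have t: "c' x t = 0" unfolding t_def using r(1) by (simp add: blinfun.diff_right)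
    \<comment> \<open>Here the choice of the normal space acts:
      \<open>Lh x n \<bullet> t = 0\<close> removes the normal step, a term that is in general only
      of first order. The remaining brackets compare \<open>x - p\<close> and s with the same
      functional \<open>f' x\<close>.\<close>
    have "Lh x t \<bullet> t = (Lh x (x - p) \<bullet> t - f' x t) - (Lh x s \<bullet> t - f' x t) - Lh x r \<bullet> t"
      unfolding t_def[symmetric] using n(2)[OF t] by (subst t_def) (simp add: d_def Ldiff)
    moreover have "\<bar>Lh x r \<bullet> t\<bar> \<le> K * (R * (C3 * ?E)) * norm t"
    proof -
      have "\<bar>Lh x r \<bullet> t\<bar> \<le> K * norm r * norm t" using elim(3) by blast
      also have "\<dots> \<le> K * (R * (C3 * ?E)) * norm t"
        using nr K(1) by (intro mult_right_mono mult_left_mono) auto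
      finally show ?thesis .
    qed
    ultimately have "Lh x t \<bullet> t \<le> C1 * ?E * norm t + C2 * ?E * norm t + K * (R * (C3 * ?E)) * norm t"
      using s(2)[OF t] elim(4)[rule_format, OF t] by linarith
    with elim(2)[rule_format, OF t]
    have "m * (norm t)\<^sup>2 \<le> C1 * ?E * norm t + C2 * ?E * norm t + K * (R * (C3 * ?E)) * norm t" by linarith
    then have "(norm t)\<^sup>2 \<le> (?Q * ?E) * norm t" using m(1) by (simp add: field_simps)
    then have "norm t \<le> ?Q * ?E"
      by (rule le_of_power2_le_mult) (use C1(1) C2(1) C3(1) K(1) R(1) m(1) in simp)
    moreover have "norm d \<le> norm t + norm r" unfolding t_def using norm_triangle_ineq[of "d - r" r] by simp
    ultimately have "norm d \<le> ?Q * ?E + R * (C3 * ?E)" using nr by linarith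
    then show ?case unfolding step by (simp add: algebra_simps)
  qed
  moreover have "0 < ?Q + R * C3" using R(1) m(1) K(1) C1(1) C2(1) C3(1) by (simp add: add_pos_pos)
  ultimately show ?thesis by blast
qed

lemma ev_landing_step_defined: "\<forall>\<^sub>F x in nhds p. landing_step_defined f c G A x"
  using ev_ball ev_surj ev_ev_surj ev_regular riem_hess_bij
proof eventually_elim
  case (elim x)
  have "Dv c x = c' x" using frechet_derivative_at[OF c_deriv[OF elim(1)]] by simp
  then show ?case
    unfolding landing_step_defined_def
    using elim riem_grad_well_defined(1)[OF elim(1,2)] riem_grad_derivative(1)[OF elim(1,3)]
      bij_of_positive_definite[OF G_inner_pos] bij_and_pinv_g(1)[where G=G, OF c_deriv[OF elim(1)] elim(2) G_inner_pos]
    by simp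
qed

theorem landing_iter_quadratic_convergence:
  "\<exists>\<delta>>0. \<exists>\<gamma>>0. \<forall>x0\<in>ball p \<delta>.
     (\<forall>k. landing_step_defined f c G A (landing_iter f c G A x0 k)) \<and>
     landing_iter f c G A x0 \<longlonglongrightarrow> p \<and>
     (\<forall>k. norm (landing_iter f c G A x0 (Suc k) - p) \<le> \<gamma> * (norm (landing_iter f c G A x0 k - p))\<^sup>2)"
proof -
  obtain \<gamma> where \<gamma>: "0 < \<gamma>"
      "\<forall>\<^sub>F x in nhds p. norm (landing_step f c G A x - p) \<le> \<gamma> * (norm (x - p))\<^sup>2"
    using landing_step_error by blast
  from eventually_conj[OF \<gamma>(2) ev_landing_step_defined]
  obtain d where d: "0 < d" "\<And>x. norm (x - p) < d \<Longrightarrow> norm (landing_step f c G A x - p) \<le> \<gamma> * (norm (x - p))\<^sup>2"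
      "\<And>x. norm (x - p) < d \<Longrightarrow> landing_step_defined f c G A x"
    unfolding eventually_nhds_metric dist_norm by blast
  \<comment> \<open>The bound d keeps the iterates where the step is defined and its error estimate
    holds; the other bound gives \<gamma> * \<delta> at most 1 / 2, as halving requires.\<close>
  define \<delta> where "\<delta> = min d (1 / (2 * \<gamma>))"
  have \<delta>: "0 < \<delta>" "\<delta> \<le> d" using d(1) \<gamma>(1) by (simp_all add: \<delta>_def)
  have "\<gamma> * \<delta> \<le> \<gamma> * (1 / (2 * \<gamma>))" using \<gamma>(1) unfolding \<delta>_def by (intro mult_left_mono) auto
  then have \<gamma>\<delta>: "\<gamma> * \<delta> \<le> 1 / 2" using \<gamma>(1) by simp
  have "(\<forall>k. landing_step_defined f c G A (landing_iter f c G A x0 k)) \<and>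
     landing_iter f c G A x0 \<longlonglongrightarrow> p \<and>
     (\<forall>k. norm (landing_iter f c G A x0 (Suc k) - p) \<le> \<gamma> * (norm (landing_iter f c G A x0 k - p))\<^sup>2)"
    if "x0 \<in> ball p \<delta>" for x0
  proof -
    let ?x = "landing_iter f c G A x0"
    have x0: "norm (?x 0 - p) < \<delta>" using that by (simp add: dist_norm norm_minus_commute)
    have st: "norm (?x (Suc k) - p) \<le> \<gamma> * (norm (?x k - p))\<^sup>2" if "norm (?x k - p) < \<delta>" for k
      using d(2)[of "?x k"] that \<delta>(2) by simp
    note q = quadratic_iteration_converges[of \<gamma> \<delta> ?x p, OF \<gamma>(1) \<gamma>\<delta> x0 st]
    have "landing_step_defined f c G A (?x k)" for k
      using d(3)[of "?x k"] q(1)[of k] \<delta>(2) by simp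
    with q st show ?thesis by blast
  qed
  with \<delta>(1) \<gamma>(1) show ?thesis by blast
qed

end

lemma C2_imp_continuous: "C2 h \<Longrightarrow> continuous_on UNIV h"
  unfolding C2_def by (metis continuous_at_imp_continuous_on has_derivative_continuous)

theorem proposition5p6:
  fixes f :: "'a::euclidean_space \<Rightarrow> real"
    and c :: "'a \<Rightarrow> 'b::euclidean_space"
    and G :: "'a \<Rightarrow> 'a \<Rightarrow>\<^sub>L 'a"
    and A :: "'a \<Rightarrow> 'a \<Rightarrow>\<^sub>L 'a \<Rightarrow>\<^sub>L 'a"
    and xstar :: 'a
  assumes "DIM('b) < DIM('a)"
    and "C2 c" and "C2 f"
    and "second_derivative_lipschitz_near c xstar"
    and "second_derivative_lipschitz_near f xstar"
    and "riemannian_metric G"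
    and "connection_field c A"
    and "xstar \<in> regular_points c"
    and "constrained_local_min f c xstar"
    and "\<forall>\<xi> \<in> tangent c xstar. \<xi> \<noteq> 0 \<longrightarrow> riem_hess_E f c xstar \<xi> \<bullet> \<xi> > 0"
    and "\<forall>\<^sub>F x in nhds xstar.
           g_normal_space c G x = (lagrangian_hess f c x ` tangent c x)\<^sup>\<bottom>"
  shows "\<exists>\<delta>>0. \<forall>x0 \<in> ball xstar \<delta>.
    let x = landing_iter f c G A x0 in
      (\<forall>k. landing_step_defined f c G A (x k)) \<and>
      x \<longlonglongrightarrow> xstar \<and>
      (\<exists>\<gamma>>0. \<forall>k. norm (x (Suc k) - xstar) \<le> \<gamma> * (norm (x k - xstar))\<^sup>2)"
proof -
  obtain \<epsilon>1 Lc and c' :: "'a \<Rightarrow> 'a \<Rightarrow>\<^sub>L 'b" and c'' where c: "0 < \<epsilon>1"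
      "\<And>x. x \<in> ball xstar \<epsilon>1 \<Longrightarrow> (c has_derivative c' x) (at x)"
      "\<And>x. x \<in> ball xstar \<epsilon>1 \<Longrightarrow> (c' has_derivative blinfun_apply (c'' x)) (at x)"
      "Lc-lipschitz_on (ball xstar \<epsilon>1) c''"
    using assms(4) unfolding second_derivative_lipschitz_near_def by blast
  obtain \<epsilon>2 Lf and f' :: "'a \<Rightarrow> 'a \<Rightarrow>\<^sub>L real" and f'' where f: "0 < \<epsilon>2"
      "\<And>x. x \<in> ball xstar \<epsilon>2 \<Longrightarrow> (f has_derivative f' x) (at x)"
      "\<And>x. x \<in> ball xstar \<epsilon>2 \<Longrightarrow> (f' has_derivative blinfun_apply (f'' x)) (at x)"
      "Lf-lipschitz_on (ball xstar \<epsilon>2) f''"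
    using assms(5) unfolding second_derivative_lipschitz_near_def by blast
  obtain G' :: "'a \<Rightarrow> 'a \<Rightarrow>\<^sub>L 'a \<Rightarrow>\<^sub>L 'a" where
      G: "\<And>x. (G has_derivative blinfun_apply (G' x)) (at x)" "continuous_on UNIV G'"
    using assms(6) unfolding riemannian_metric_def C1_def by blast
  \<comment> \<open>One radius for both functions; derivatives and Lipschitz bounds restrict to the
    smaller ball.\<close>
  define \<epsilon> where "\<epsilon> = min \<epsilon>1 \<epsilon>2"
  have sub: "ball xstar \<epsilon> \<subseteq> ball xstar \<epsilon>1" "ball xstar \<epsilon> \<subseteq> ball xstar \<epsilon>2" "0 < \<epsilon>"
    using c(1) f(1) by (auto simp: \<epsilon>_def)
  interpret newton_landing f c G A xstar \<epsilon> Lc Lf c' c'' f' f'' G'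
  proof
    show "Lc-lipschitz_on (ball xstar \<epsilon>) c''" "Lf-lipschitz_on (ball xstar \<epsilon>) f''"
      using lipschitz_on_subset[OF c(4) sub(1)] lipschitz_on_subset[OF f(4) sub(2)] by auto
    show "continuous_on UNIV c" "continuous_on UNIV f" using assms(2,3) by (auto intro: C2_imp_continuous)
    show "u \<noteq> 0 \<Longrightarrow> gmetric G x u u > 0" for x u using assms(6) by (simp add: riemannian_metric_def)
  qed (use assms(7-11) c f G sub in auto)
  show ?thesis
    using landing_iter_quadratic_convergence unfolding Let_def by blast
qed

end
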